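(* Suppose the MDP is uniformly ergodic, let $\gamma\in[1/2,1)$ with $t_{\mathrm{minorize}}\le(1-\gamma)^{-1}$, let $\zeta>0$, $\delta\in(0,1)$, and let $n\ge 64\,\beta_\delta(\eta^*_\delta)(1-\gamma)^{-1}$. Then the policy $\hat\pi_0$ returned by PMBP$(\gamma,\zeta,n)$ satisfies, with probability at least $1-\delta$, \[ 0\le v^*-v^{\hat\pi_0}\le \frac{2\zeta}{1-\gamma}+486\sqrt{\frac{\beta_\delta(\eta^*_\delta)\,t_{\mathrm{minorize}}}{(1-\gamma)^2 n}} \] (entrywise). Consequently, choosing $\zeta=(1-\gamma)\epsilon/4$ and $n=\frac{c\,t_{\mathrm{minorize}}\,\beta_\delta(\eta^*_\delta)}{(1-\gamma)^2\epsilon^2}$ with $c=4\cdot486^2$, for any $0<\epsilon\le\sqrt{t_{\mathrm{minorize}}/(1-\gamma)}$ one has $\|v^*-v^{\hat\pi_0}\|_\infty\le\epsilon$ with probability at least $1-\delta$, using a total of $|S||A|n=\widetilde O\big(|S||A|t_{\mathrm{minorize}}(1-\gamma)^{-2}\epsilon^{-2}\big)$ samples.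
   Context: $S,A$ finite; reward $r:S\times A\to[0,1]$; kernel $P=\{p_{s,a}\in\mathcal P(S)\}$; $p[v]=\sum_s p(s)v(s)$. $\Pi$ = deterministic stationary Markov policies $\pi:S\to A$; $P_\pi(s,s')=p_{s,\pi(s)}(s')$, $r_\pi(s)=r(s,\pi(s))$. Discounted value $v^\pi=(I-\gamma P_\pi)^{-1}r_\pi$ and $v^*(s)=\max_{\pi\in\Pi}v^\pi(s)$. Uniform ergodicity: for every $\pi\in\Pi$ there exist an integer $m\ge1$, $q\in(0,1]$, $\psi\in\mathcal P(S)$ with $P_\pi^m(s,\cdot)\ge q\psi(\cdot)$ for all $s$. $t_{\mathrm{minorize}}(P_\pi)=\inf\{m/q:\ P_\pi^m(s,\cdot)\ge q\psi(\cdot)\ \forall s\text{ for some }\psi\}$, $t_{\mathrm{minorize}}=\max_{\pi}t_{\mathrm{minorize}}(P_\pi)$. Algorithm PMBP$(\gamma,\zeta,n)$: draw $Z(s,a)\sim\mathrm{Unif}(0,\zeta)$ i.i.d. over $(s,a)$, set $R=r+Z$; independently, for each $(s,a)$ draw $n$ i.i.d. samples from $p_{s,a}$ via a generative model and form the empirical distribution $\hat p_{s,a}$; compute the unique $\hat v_0$ with $\hat v_0(s)=\max_a\{R(s,a)+\gamma\hat p_{s,a}[\hat v_0]\}$ and return $\hat\pi_0(s)\in\arg\max_a\{R(s,a)+\gamma\hat p_{s,a}[\hat v_0]\}$. $\beta_\delta(\eta)=2\log\!\Big(\frac{24|S||A|\log_2((1-\gamma)^{-1})}{(1-\gamma)^2\eta\delta}\Big)$,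 $\eta^*_\delta=\frac{\zeta\delta(1-\gamma)}{9|S||A|^2}$. *)

theory Defs
  imports "HOL-Probability.Probability"
begin

text \<open>Finite MDP: states 's::finite, actions 'a::finite, reward r s a, kernel P s a :: 's pmf.
  Deterministic stationary Markov policies are functions pol :: 's => 'a.\<close>

fun mat_pow :: "real^'n^'n \<Rightarrow> nat \<Rightarrow> real^'n^'n" where
  "mat_pow M 0 = mat 1"
| "mat_pow M (Suc k) = M ** mat_pow M k"

definition trans_mat :: "('s::finite \<Rightarrow> 'a \<Rightarrow> 's pmf) \<Rightarrow> ('s \<Rightarrow> 'a) \<Rightarrow> real^'s^'s" where
  "trans_mat P pol = (\<chi> s s'. pmf (P s (pol s)) s')"

definition rew_vec :: "('s::finite \<Rightarrow> 'a \<Rightarrow> real) \<Rightarrow> ('s \<Rightarrow> 'a) \<Rightarrow> real^'s" where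
  "rew_vec r pol = (\<chi> s. r s (pol s))"

definition pol_value :: "real \<Rightarrow> ('s::finite \<Rightarrow> 'a \<Rightarrow> 's pmf) \<Rightarrow> ('s \<Rightarrow> 'a \<Rightarrow> real)
    \<Rightarrow> ('s \<Rightarrow> 'a) \<Rightarrow> 's \<Rightarrow> real" where
  "pol_value \<gamma> P r pol s = (matrix_inv (mat 1 - \<gamma> *\<^sub>R trans_mat P pol) *v rew_vec r pol) $ s"

definition opt_value :: "real \<Rightarrow> ('s::finite \<Rightarrow> 'a::finite \<Rightarrow> 's pmf) \<Rightarrow> ('s \<Rightarrow> 'a \<Rightarrow> real)
    \<Rightarrow> 's \<Rightarrow> real" where
  "opt_value \<gamma> P r s = Max ((\<lambda>pol. pol_value \<gamma> P r pol s) ` UNIV)"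

definition minorizes :: "real^'s^'s \<Rightarrow> nat \<Rightarrow> real \<Rightarrow> ('s::finite) pmf \<Rightarrow> bool" where
  "minorizes M m q \<psi> \<longleftrightarrow> (\<forall>s s'. mat_pow M m $ s $ s' \<ge> q * pmf \<psi> s')"

definition uniformly_ergodic :: "('s::finite \<Rightarrow> 'a \<Rightarrow> 's pmf) \<Rightarrow> bool" where
  "uniformly_ergodic P \<longleftrightarrow>
     (\<forall>pol. \<exists>m q \<psi>. m \<ge> 1 \<and> 0 < q \<and> q \<le> 1 \<and> minorizes (trans_mat P pol) m q \<psi>)"

definition t_minorize_pol :: "('s::finite \<Rightarrow> 'a \<Rightarrow> 's pmf) \<Rightarrow> ('s \<Rightarrow> 'a) \<Rightarrow> real" where
  "t_minorize_pol P pol =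
     Inf {real m / q | m q. m \<ge> 1 \<and> 0 < q \<and> q \<le> 1 \<and> (\<exists>\<psi>. minorizes (trans_mat P pol) m q \<psi>)}"

definition t_minorize :: "('s::finite \<Rightarrow> 'a::finite \<Rightarrow> 's pmf) \<Rightarrow> real" where
  "t_minorize P = Max (range (t_minorize_pol P))"

definition beta_delta :: "'s::finite itself \<Rightarrow> 'a::finite itself \<Rightarrow> real \<Rightarrow> real \<Rightarrow> real \<Rightarrow> real" where
  "beta_delta _ _ \<gamma> \<delta> \<eta> =
     2 * ln (24 * real CARD('s) * real CARD('a) * log 2 (1 / (1 - \<gamma>))
              / ((1 - \<gamma>)^2 * \<eta> * \<delta>))"

definition eta_star :: "'s::finite itself \<Rightarrow> 'a::finite itself \<Rightarrow> real \<Rightarrow> real \<Rightarrow> real \<Rightarrow> real" where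
  "eta_star _ _ \<gamma> \<zeta> \<delta> = \<zeta> * \<delta> * (1 - \<gamma>) / (9 * real CARD('s) * (real CARD('a))^2)"

text \<open>Randomness of PMBP(gamma, zeta, n): the perturbation Z (i.i.d. Unif(0,zeta) over (s,a))
  and, independently, n i.i.d. samples X (s,a) i ~ p_{s,a}, i < n, for each (s,a).\<close>
definition pmbp_space :: "('s::finite \<Rightarrow> 'a::finite \<Rightarrow> 's pmf) \<Rightarrow> real \<Rightarrow> nat
    \<Rightarrow> (('s \<times> 'a \<Rightarrow> real) \<times> ('s \<times> 'a \<Rightarrow> nat \<Rightarrow> 's)) measure" where
  "pmbp_space P \<zeta> n =
     (PiM UNIV (\<lambda>_. uniform_measure lborel {0<..<\<zeta>}))
     \<Otimes>\<^sub>M (PiM UNIV (\<lambda>sa. PiM {..<n} (\<lambda>_. measure_pmf (P (fst sa) (snd sa)))))"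

definition emp_dist :: "('s \<times> 'a \<Rightarrow> nat \<Rightarrow> 's) \<Rightarrow> nat \<Rightarrow> 's \<Rightarrow> 'a \<Rightarrow> 's \<Rightarrow> real" where
  "emp_dist X n s a s' = real (card {i. i < n \<and> X (s, a) i = s'}) / real n"

definition pert_reward :: "('s \<Rightarrow> 'a \<Rightarrow> real) \<Rightarrow> ('s \<times> 'a \<Rightarrow> real) \<Rightarrow> 's \<Rightarrow> 'a \<Rightarrow> real" where
  "pert_reward r Z s a = r s a + Z (s, a)"

definition emp_opt_value :: "real \<Rightarrow> ('s::finite \<Rightarrow> 'a::finite \<Rightarrow> real) \<Rightarrow> ('s \<Rightarrow> 'a \<Rightarrow> 's \<Rightarrow> real)
    \<Rightarrow> 's \<Rightarrow> real" where
  "emp_opt_value \<gamma> R ph =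
     (THE v. \<forall>s. v s = Max (range (\<lambda>a. R s a + \<gamma> * (\<Sum>s'\<in>UNIV. ph s a s' * v s'))))"

definition pmbp_output :: "real \<Rightarrow> ('s::finite \<Rightarrow> 'a::finite \<Rightarrow> real) \<Rightarrow> nat
    \<Rightarrow> ('s \<times> 'a \<Rightarrow> real) \<times> ('s \<times> 'a \<Rightarrow> nat \<Rightarrow> 's) \<Rightarrow> ('s \<Rightarrow> 'a) \<Rightarrow> bool" where
  "pmbp_output \<gamma> r n \<omega> pol \<longleftrightarrow>
     (let R = pert_reward r (fst \<omega>); ph = emp_dist (snd \<omega>) n; v = emp_opt_value \<gamma> R ph
      in \<forall>s. pol s \<in> {a. \<forall>b. R s b + \<gamma> * (\<Sum>s'\<in>UNIV. ph s b s' * v s')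
                               \<le> R s a + \<gamma> * (\<Sum>s'\<in>UNIV. ph s a s' * v s')})"

end

theory Submission
  imports Defs
begin

text \<open>Under the perturbed reward, the returned policy and an optimal policy of the true model are
  compared through the difference between their empirical and true values. For a policy that is
  optimal within some action sets, this difference is controlled by concentration of the empirical
  means of its empirical value function. That function depends on the samples at a state only
  through its value there, so it is replaced by one whose value at that state is pinned to a point
  of a net of resolution proportional to \<open>\<zeta>\<close>, to which Bernstein's inequality applies conditionally
  on the other samples. The resulting discounted standard deviations split into that of the true
  value function, bounded by its oscillation and hence by the minorization time, and that of the
  error itself, which is absorbed as soon as \<open>n\<close> exceeds a constant times \<open>\<beta> / (1 - \<gamma>)\<close>. No gap
  between actions is needed, so the perturbation only costs \<open>\<zeta> / (1 - \<gamma>)\<close>.\<close>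

section \<open>Means, variances and oscillations on a finite type\<close>

text \<open>The empirical value function is built from the very samples whose deviation it is tested
  against, so Bernstein's inequality does not apply to it directly. Concentration is therefore
  demanded for every state, action and net point at once; the random choice of policy and net point
  then costs only a union bound over about
  \<open>2 * |S| * |A| * 25 / ((1 - \<gamma>) * \<zeta>)\<close> events, which the logarithm in
  \<open>\<beta>\<close> outweighs. Two assignments of action sets suffice, both fixed before
  sampling: all actions, for the output, and the singletons of a policy optimal for \<open>r\<close>
  and \<open>P\<close>. Bounding each standard deviation by the oscillation \<open>D\<close> would
  give an error of order \<open>D * sqrt l / (1 - \<gamma>)\<close>, whereas
  \<open>sqrt (l * D) / (1 - \<gamma>)\<close> is required. The gain comes from telescoping: for a
  centred value function the one-step variance is, up to a multiple of \<open>D\<close>, a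
  discounted difference of squares, so discounted variances sum to order
  \<open>D / (1 - \<gamma>)\<close>. Perturbed rewards are kept below 3/2, hence the split at
  \<open>\<zeta> = 1/2\<close>; beyond it the claimed bound exceeds any possible gap.\<close>

definition pmf_mean :: "'s::finite pmf \<Rightarrow> ('s \<Rightarrow> real) \<Rightarrow> real" where
  "pmf_mean p f = (\<Sum>s\<in>UNIV. pmf p s * f s)"

definition pmf_var :: "'s::finite pmf \<Rightarrow> ('s \<Rightarrow> real) \<Rightarrow> real" where
  "pmf_var p f = pmf_mean p (\<lambda>s. (f s - pmf_mean p f)\<^sup>2)"

definition pmf_sd :: "'s::finite pmf \<Rightarrow> ('s \<Rightarrow> real) \<Rightarrow> real" where
  "pmf_sd p f = sqrt (pmf_var p f)"

text \<open>The span seminorm. It does not see additive constants, so a value function of size about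
  \<open>1 / (1 - \<gamma>)\<close> can still be small in it.\<close>

definition osc :: "('s::finite \<Rightarrow> real) \<Rightarrow> real" where
  "osc f = Max (range f) - Min (range f)"

lemma sum_pmf_UNIV: "(\<Sum>s\<in>UNIV. pmf p (s::'s::finite)) = 1"
  by (rule sum_pmf_eq_1) auto

lemma pmf_mean_const [simp]: "pmf_mean p (\<lambda>_. c) = c"
  by (simp add: pmf_mean_def sum_pmf_UNIV flip: sum_distrib_right)

lemma pmf_mean_add: "pmf_mean p (\<lambda>s. f s + g s) = pmf_mean p f + pmf_mean p g"
  by (simp add: pmf_mean_def algebra_simps sum.distrib)

lemma pmf_mean_diff: "pmf_mean p (\<lambda>s. f s - g s) = pmf_mean p f - pmf_mean p g"
  by (simp add: pmf_mean_def algebra_simps sum_subtractf)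

lemma pmf_mean_cmult: "pmf_mean p (\<lambda>s. c * f s) = c * pmf_mean p f"
  by (simp add: pmf_mean_def algebra_simps sum_distrib_left)

lemma pmf_mean_mono: "(\<And>s. f s \<le> g s) \<Longrightarrow> pmf_mean p f \<le> pmf_mean p g"
  by (auto simp: pmf_mean_def intro!: sum_mono mult_left_mono)

lemma pmf_mean_le: "(\<And>s. f s \<le> c) \<Longrightarrow> pmf_mean p f \<le> c"
  using pmf_mean_mono[of f "\<lambda>_. c" p] by simp

lemma pmf_mean_ge: "(\<And>s. c \<le> f s) \<Longrightarrow> c \<le> pmf_mean p f"
  using pmf_mean_mono[of "\<lambda>_. c" f p] by simp

lemma pmf_mean_abs_diff_le:
  assumes "\<And>s. \<bar>f s - g s\<bar> \<le> e"
  shows "\<bar>pmf_mean p f - pmf_mean p g\<bar> \<le> e"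
proof -
  have "- e \<le> f s - g s" "f s - g s \<le> e" for s using assms[of s] by auto
  then have "pmf_mean p (\<lambda>s. f s - g s) \<le> e" "- e \<le> pmf_mean p (\<lambda>s. f s - g s)"
    by (auto intro: pmf_mean_le pmf_mean_ge)
  then show ?thesis by (simp add: pmf_mean_diff)
qed

lemma pmf_var_nonneg: "0 \<le> pmf_var p f"
  unfolding pmf_var_def by (rule pmf_mean_ge) simp

lemma pmf_var_altdef: "pmf_var p f = pmf_mean p (\<lambda>s. (f s)\<^sup>2) - (pmf_mean p f)\<^sup>2"
proof -
  have "pmf_var p f = pmf_mean p (\<lambda>s. (f s)\<^sup>2 + ((pmf_mean p f)\<^sup>2 - (2 * pmf_mean p f) * f s))"
    unfolding pmf_var_def by (intro arg_cong[where f="pmf_mean p"] ext) (simp add: power2_diff algebra_simps)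
  also have "\<dots> = pmf_mean p (\<lambda>s. (f s)\<^sup>2) - (pmf_mean p f)\<^sup>2"
    by (simp add: pmf_mean_add pmf_mean_diff pmf_mean_cmult) (simp add: power2_eq_square)
  finally show ?thesis .
qed

lemma pmf_var_shift: "pmf_var p (\<lambda>s. f s - c) = pmf_var p f"
  by (simp add: pmf_var_def pmf_mean_diff)

lemma pmf_sd_nonneg [simp]: "0 \<le> pmf_sd p f"
  by (simp add: pmf_sd_def pmf_var_nonneg)

lemma pmf_sd_power2: "(pmf_sd p f)\<^sup>2 = pmf_var p f"
  by (simp add: pmf_sd_def pmf_var_nonneg)

text \<open>A Euclidean norm of a vector linear in \<open>f\<close>: subadditivity of the standard
  deviation becomes Minkowski's inequality.\<close>

lemma pmf_sd_L2_set: "pmf_sd p f = L2_set (\<lambda>s. sqrt (pmf p s) * (f s - pmf_mean p f)) UNIV"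
  by (simp add: pmf_sd_def pmf_var_def pmf_mean_def[of p "\<lambda>s. (f s - pmf_mean p f)\<^sup>2"]
      L2_set_def power_mult_distrib)

lemma pmf_sd_add_le: "pmf_sd p (\<lambda>s. f s + g s) \<le> pmf_sd p f + pmf_sd p g"
  unfolding pmf_sd_L2_set
  by (rule order.trans[OF eq_refl L2_set_triangle_ineq]) (simp add: pmf_mean_add algebra_simps)

lemma pmf_sd_le:
  assumes "\<And>s. \<bar>f s\<bar> \<le> e"
  shows "pmf_sd p f \<le> e"
proof -
  have e: "0 \<le> e" using assms[of undefined] by linarith
  have "pmf_var p f \<le> pmf_mean p (\<lambda>s. (f s)\<^sup>2)" by (simp add: pmf_var_altdef)
  also have "\<dots> \<le> e\<^sup>2"
    by (rule pmf_mean_le) (use assms e in \<open>auto simp: abs_le_square_iff[symmetric]\<close>)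
  finally show ?thesis unfolding pmf_sd_def using e by (simp add: real_le_lsqrt)
qed

lemma osc_ge: "f s - f s' \<le> osc f"
proof -
  have "f s \<le> Max (range f)" "Min (range f) \<le> f s'" by auto
  then show ?thesis unfolding osc_def by linarith
qed

lemma osc_le:
  assumes "\<And>s s'. f s - f s' \<le> D"
  shows "osc f \<le> D"
proof -
  have "Max (range f) \<in> range f" "Min (range f) \<in> range f" by (intro Max_in Min_in; simp)+
  then obtain s s' where "Max (range f) = f s" "Min (range f) = f s'"
    unfolding image_iff by blast
  then show ?thesis using assms[of s s'] by (simp add: osc_def)
qed

lemma osc_nonneg: "0 \<le> osc f"
  using osc_ge[of f undefined undefined] by simp

lemma osc_perturb_le:
  assumes "\<And>s. \<bar>f s - g s\<bar> \<le> e"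
  shows "osc f \<le> osc g + 2 * e"
proof (rule osc_le)
  fix s s'
  show "f s - f s' \<le> osc g + 2 * e"
    using assms[of s] assms[of s'] osc_ge[of g s s'] by linarith
qed

lemma osc_dist_mean_le: "\<bar>f s - pmf_mean p f\<bar> \<le> osc f"
proof -
  have "f s' \<le> f s + osc f" "f s - osc f \<le> f s'" for s'
    using osc_ge[of f s' s] osc_ge[of f s s'] by linarith+
  then have "pmf_mean p f \<le> f s + osc f" "f s - osc f \<le> pmf_mean p f"
    by (auto intro: pmf_mean_le pmf_mean_ge)
  then show ?thesis by linarith
qed

section \<open>Resolvents\<close>

text \<open>Maximum principle: at a maximizer \<open>s0\<close> of \<open>v - z\<close> the two
  inequalities give \<open>d s0 \<le> \<gamma> * d s0\<close>, which forces
  \<open>d s0 \<le> 0\<close>.\<close>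

lemma discounted_comparison:
  fixes K :: "'s::finite \<Rightarrow> 's pmf"
  assumes "0 \<le> \<gamma>" "\<gamma> < 1"
    and sub: "\<And>s. v s \<le> f s + \<gamma> * pmf_mean (K s) v"
    and super: "\<And>s. f s + \<gamma> * pmf_mean (K s) z \<le> z s"
  shows "v s \<le> z s"
proof -
  define d where "d = (\<lambda>s. v s - z s)"
  have "Max (range d) \<in> range d" by (rule Max_in) auto
  then obtain s0 where s0: "Max (range d) = d s0" unfolding image_iff by blast
  have le: "d s \<le> d s0" for s using s0[symmetric] by simp
  have "d s0 \<le> \<gamma> * pmf_mean (K s0) d"
    unfolding d_def pmf_mean_diff using sub[of s0] super[of s0] by (simp add: algebra_simps)
  also have "\<dots> \<le> \<gamma> * d s0" by (intro mult_left_mono pmf_mean_le le assms)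
  finally have "(1 - \<gamma>) * d s0 \<le> 0" by (simp add: algebra_simps)
  with assms have "d s0 \<le> 0" by (simp add: mult_le_0_iff)
  with le[of s] show ?thesis by (simp add: d_def)
qed

text \<open>Written with \<open>matrix_inv\<close> so that \<open>pol_value\<close> is an instance
  by unfolding; later arguments use only the fixed point equation.\<close>

definition resolvent :: "real \<Rightarrow> ('s::finite \<Rightarrow> 's pmf) \<Rightarrow> ('s \<Rightarrow> real) \<Rightarrow> 's \<Rightarrow> real" where
  "resolvent \<gamma> K f s =
     (matrix_inv (mat 1 - \<gamma> *\<^sub>R (\<chi> s s'. pmf (K s) s')) *v (\<chi> s. f s)) $ s"

lemma pol_value_eq_resolvent:
  "pol_value \<gamma> P r pol = resolvent \<gamma> (\<lambda>s. P s (pol s)) (\<lambda>s. r s (pol s))"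
  by (simp add: fun_eq_iff pol_value_def resolvent_def trans_mat_def rew_vec_def)

lemma discounted_unique:
  fixes K :: "'s::finite \<Rightarrow> 's pmf"
  assumes "0 \<le> \<gamma>" "\<gamma> < 1"
    and "\<And>s. v s = f s + \<gamma> * pmf_mean (K s) v"
    and "\<And>s. z s = f s + \<gamma> * pmf_mean (K s) z"
  shows "v = z"
proof (rule ext, rule antisym)
  fix s
  show "v s \<le> z s"
    by (rule discounted_comparison[where f=f and K=K, OF assms(1,2)]) (metis assms(3,4) order_refl)+
  show "z s \<le> v s"
    by (rule discounted_comparison[where f=f and K=K, OF assms(1,2)]) (metis assms(3,4) order_refl)+
qed

text \<open>Uniqueness for zero reward says that \<open>I - \<gamma> K\<close> has trivial kernel,
  so this square matrix is invertible and \<open>matrix_inv\<close> is a true inverse.\<close>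

lemma resolvent_eq:
  fixes K :: "'s::finite \<Rightarrow> 's pmf"
  assumes "0 \<le> \<gamma>" "\<gamma> < 1"
  shows "resolvent \<gamma> K f s = f s + \<gamma> * pmf_mean (K s) (resolvent \<gamma> K f)"
proof -
  define A :: "real^'s^'s" where "A = mat 1 - \<gamma> *\<^sub>R (\<chi> s s'. pmf (K s) s')"
  have A: "(A *v x) $ s = x $ s - \<gamma> * pmf_mean (K s) (\<lambda>s'. x $ s')" for x s
    by (simp add: A_def matrix_vector_mult_diff_rdistrib scaleR_matrix_vector_assoc[symmetric])
      (simp add: matrix_vector_mult_def pmf_mean_def)
  have "x = 0" if "A *v x = 0" for x
  proof -
    have "x $ s = 0 + \<gamma> * pmf_mean (K s) (\<lambda>s'. x $ s')" for s
      using A[of x s] that by simp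
    from discounted_unique[OF assms this, of "\<lambda>_. 0"] have "(\<lambda>s. x $ s) = (\<lambda>_. 0)" by simp
    then show ?thesis by (simp add: vec_eq_iff fun_eq_iff)
  qed
  then have "invertible A"
    by (simp add: invertible_left_inverse matrix_left_invertible_ker)
  then have "A ** matrix_inv A = mat 1" 
    unfolding matrix_inv_def invertible_def by (rule someI2_ex) simp
  then have "A *v (matrix_inv A *v (\<chi> s. f s)) = (\<chi> s. f s)"
    by (simp add: matrix_vector_mul_assoc)
  then have "(A *v (\<chi> s. resolvent \<gamma> K f s)) $ s = f s"
    by (simp add: resolvent_def A_def)
  then show ?thesis unfolding A by (simp add: vec_lambda_beta[abs_def])
qed

lemma resolvent_unique:
  assumes "0 \<le> \<gamma>" "\<gamma> < 1" "\<And>s. v s = f s + \<gamma> * pmf_mean (K s) v"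
  shows "v = resolvent \<gamma> K f"
  by (rule discounted_unique[OF assms resolvent_eq]) (use assms in auto)

lemma resolvent_le:
  assumes "0 \<le> \<gamma>" "\<gamma> < 1" "\<And>s. f s + \<gamma> * pmf_mean (K s) z \<le> z s"
  shows "resolvent \<gamma> K f s \<le> z s"
  by (rule discounted_comparison[where f=f and K=K, OF assms(1,2)])
    (use assms in \<open>auto simp flip: resolvent_eq\<close>)

lemma resolvent_ge:
  assumes "0 \<le> \<gamma>" "\<gamma> < 1" "\<And>s. z s \<le> f s + \<gamma> * pmf_mean (K s) z"
  shows "z s \<le> resolvent \<gamma> K f s"
  by (rule discounted_comparison[where f=f and K=K, OF assms(1,2)])
    (use assms in \<open>auto simp flip: resolvent_eq\<close>)

lemma resolvent_le_const:
  assumes "0 \<le> \<gamma>" "\<gamma> < 1" "\<And>s. f s \<le> c"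
  shows "resolvent \<gamma> K f s \<le> c / (1 - \<gamma>)"
proof (rule resolvent_le[OF assms(1,2)])
  fix s
  have "c + \<gamma> * (c / (1 - \<gamma>)) = c / (1 - \<gamma>)" using assms(2) by (simp add: field_simps)
  with assms(3)[of s] show "f s + \<gamma> * pmf_mean (K s) (\<lambda>_. c / (1 - \<gamma>)) \<le> c / (1 - \<gamma>)" by simp
qed

lemma resolvent_nonneg:
  assumes "0 \<le> \<gamma>" "\<gamma> < 1" "\<And>s. 0 \<le> f s"
  shows "0 \<le> resolvent \<gamma> K f s"
  by (rule resolvent_ge[where z="\<lambda>_. 0"]) (use assms in auto)

text \<open>Up to the error \<open>2 * B * g\<close>, the right-hand side is minus
  \<open>I - \<gamma> K\<close> applied to the square of \<open>x\<close>, so that discounted sums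
  of variances telescope.\<close>

lemma discounted_var_le:
  assumes "0 \<le> \<gamma>" "\<gamma> \<le> 1" "\<bar>x s - \<gamma> * pmf_mean p x\<bar> \<le> g" "\<bar>x s\<bar> \<le> B"
  shows "\<gamma>\<^sup>2 * pmf_var p x \<le> \<gamma> * pmf_mean p (\<lambda>s. (x s)\<^sup>2) - (x s)\<^sup>2 + 2 * B * g"
proof -
  define h where "h = x s - \<gamma> * pmf_mean p x"
  have "x s * h \<le> \<bar>x s\<bar> * \<bar>h\<bar>" by (metis abs_ge_self abs_mult)
  also have "\<dots> \<le> B * g" using assms by (intro mult_mono) (auto simp: h_def)
  finally have xh: "x s * h \<le> B * g" .
  have "(\<gamma> * pmf_mean p x)\<^sup>2 = (x s)\<^sup>2 - 2 * (x s * h) + h\<^sup>2"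
    by (simp add: h_def power2_eq_square algebra_simps)
  then have 1: "(\<gamma> * pmf_mean p x)\<^sup>2 \<ge> (x s)\<^sup>2 - 2 * (B * g)" using xh by (smt (verit) zero_le_power2)
  have "0 \<le> pmf_mean p (\<lambda>s. (x s)\<^sup>2)" by (rule pmf_mean_ge) simp
  moreover have "\<gamma>\<^sup>2 \<le> \<gamma>" using assms by (simp add: power2_eq_square mult_left_le)
  ultimately have "\<gamma>\<^sup>2 * pmf_mean p (\<lambda>s. (x s)\<^sup>2) \<le> \<gamma> * pmf_mean p (\<lambda>s. (x s)\<^sup>2)"
    by (rule mult_right_mono[rotated])
  with 1 show ?thesis by (simp add: pmf_var_altdef algebra_simps power_mult_distrib)
qed

section \<open>Value error of a policy under an empirical kernel\<close>

text \<open>The midpoint of the range works. That it lies between \<open>a\<close> and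
  \<open>b\<close> matters as much as the radius: it bounds the reward left after centring a value
  function.\<close>

lemma osc_midpointE:
  fixes f :: "'s::finite \<Rightarrow> real"
  assumes "osc f \<le> D" "\<And>s. a \<le> f s" "\<And>s. f s \<le> b"
  obtains c where "a \<le> c" "c \<le> b" "\<And>s. \<bar>f s - c\<bar> \<le> D / 2"
proof
  define M m where "M = Max (range f)" and "m = Min (range f)"
  have "M \<in> range f" "m \<in> range f" unfolding M_def m_def by (intro Max_in Min_in; simp)+
  then obtain s s' where *: "M = f s" "m = f s'"
    unfolding image_iff by blast
  show "a \<le> (M + m) / 2" "(M + m) / 2 \<le> b" unfolding * using assms(2,3)[of s] assms(2,3)[of s'] by auto
  have "M - m \<le> D" using assms(1) by (simp add: osc_def M_def m_def)
  moreover have "f t \<le> M" "m \<le> f t" for t by (auto simp: M_def m_def)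
  ultimately have *: "2 * f t - (M + m) \<le> D" "(M + m) - 2 * f t \<le> D" for t
    by (smt (verit))+
  show "\<bar>f t - (M + m) / 2\<bar> \<le> D / 2" for t
    using *[of t] unfolding abs_le_iff by (auto simp: field_simps)
qed

text \<open>Writing \<open>x\<close> for the error, the variance of \<open>uh\<close> splits into the variances of \<open>u\<close> and \<open>x\<close>.
  Both have explicit discounted supersolutions, and the one for \<open>x\<close> is controlled by the very bound
  \<open>Y\<close> on \<open>\<bar>x\<bar>\<close> that is being estimated; as \<open>l\<close> is small compared with \<open>1 - \<gamma>\<close>, it is absorbed.\<close>

lemma policy_error:
  fixes K Kh :: "'s::finite \<Rightarrow> 's pmf"
  assumes gamma: "1/2 \<le> \<gamma>" "\<gamma> < 1"
    and u: "\<And>s. u s = \<rho> s + \<gamma> * pmf_mean (K s) u"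
    and uh: "\<And>s. uh s = \<rho> s + \<gamma> * pmf_mean (Kh s) uh"
    and rho: "\<And>s. 0 \<le> \<rho> s" "\<And>s. \<rho> s \<le> 3/2"
    and D: "osc u \<le> D" "0 < D" "D \<le> (3/2) / (1 - \<gamma>)"
    and l: "0 < l" "128 * l \<le> 1 - \<gamma>"
    and e: "0 \<le> e"
    and conc: "\<And>s. \<bar>pmf_mean (Kh s) uh - pmf_mean (K s) uh\<bar>
                \<le> 2 * sqrt l * (pmf_sd (K s) uh + e) + l * (osc uh + 2 * e) + 2 * e"
  shows "\<bar>uh s - u s\<bar> \<le> (11 * sqrt (l * D) + 7 * e) / (1 - \<gamma>)"
proof -
  define H where "H = 1 / (1 - \<gamma>)"
  define a where "a = sqrt (l * D)"
  have g0: "0 \<le> \<gamma>" "0 < 1 - \<gamma>" "\<gamma> \<le> 1" using gamma by auto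
  have H: "0 < H" "H * (1 - \<gamma>) = 1" "128 * (H * l) \<le> 1" "l * D * 128 \<le> 3/2"
  proof -
    show "0 < H" "H * (1 - \<gamma>) = 1" using g0 by (auto simp: H_def)
    show "128 * (H * l) \<le> 1" using l g0 by (auto simp: H_def field_simps)
    have "(128 * l) * D \<le> (1 - \<gamma>) * ((3/2) / (1 - \<gamma>))" (is "_ \<le> _ * (?c / _)") using l D g0 by (intro mult_mono) auto
    also have "\<dots> = ?c" using g0 by (metis less_irrefl nonzero_mult_div_cancel_left times_divide_eq_right)
    finally show "l * D * 128 \<le> 3/2" by simp
  qed
  have a: "0 < a" "a\<^sup>2 = l * D" using l D by (auto simp: a_def)
  \<comment> \<open>By \<open>H(4)\<close> the square of \<open>a\<close> is at most 3/256 <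
    0.0121.\<close>
  have a_small: "a \<le> 0.11"
    by (rule power2_le_imp_le) (use H(4) a(2) in \<open>auto simp: power2_eq_square\<close>)
  define x where "x = (\<lambda>s. uh s - u s)"
  define b where "b = (\<lambda>s. \<gamma> * (pmf_mean (Kh s) uh - pmf_mean (K s) uh))"
  have x: "x s = b s + \<gamma> * pmf_mean (K s) x" for s
    using u[of s] uh[of s] by (simp add: x_def b_def pmf_mean_diff algebra_simps)
  define y where "y = resolvent \<gamma> K (\<lambda>s. \<bar>b s\<bar>)"
  have y: "y s = \<bar>b s\<bar> + \<gamma> * pmf_mean (K s) y" for s
    unfolding y_def by (rule resolvent_eq) (use gamma in auto)
  have xy: "\<bar>x s\<bar> \<le> y s" for s
  proof -
    have "x s \<le> y s"
      by (rule discounted_comparison[of \<gamma> x b K y]) (use gamma x y in \<open>auto simp: x[symmetric] y[of _]\<close>)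
    moreover have "- x s \<le> y s"
    proof (rule discounted_comparison[of \<gamma> "\<lambda>s. - x s" "\<lambda>s. - b s" K y])
      show "- x s \<le> - b s + \<gamma> * pmf_mean (K s) (\<lambda>s. - x s)" for s
        using x[of s] pmf_mean_cmult[of "K s" "-1" x] by simp
    qed (use gamma y in \<open>auto simp: y[of _]\<close>)
    ultimately show ?thesis by simp
  qed
  \<comment> \<open>The maximum is taken of the majorant \<open>y\<close>, not of
    \<open>\<bar>x\<bar>\<close>: as a resolvent, \<open>y\<close> can be compared with a
    supersolution at the maximizing state.\<close>
  define Y where "Y = Max (range y)"
  have "Y \<in> range y" unfolding Y_def by (rule Max_in) auto
  then obtain s0 where s0: "Y = y s0" unfolding image_iff by blast
  have yY: "y s \<le> Y" for s unfolding Y_def by simp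
  have xY: "\<bar>x s\<bar> \<le> Y" for s using xy[of s] yY[of s] by linarith
  have Y0: "0 \<le> Y" using xY[of s0] by linarith
  have u_range: "0 \<le> u s" "u s \<le> (3/2) * H" for s
  proof -
    have "u = resolvent \<gamma> K \<rho>" by (rule resolvent_unique) (use gamma u in auto)
    then show "0 \<le> u s" "u s \<le> (3/2) * H"
      using resolvent_nonneg[of \<gamma> \<rho> K] resolvent_le_const[of \<gamma> \<rho> "3/2" K] rho gamma
      by (auto simp: H_def)
  qed
  obtain c where c: "0 \<le> c" "c \<le> (3/2) * H" "\<And>s. \<bar>u s - c\<bar> \<le> D / 2"
    using osc_midpointE[OF D(1) u_range] by blast
  define u' where "u' = (\<lambda>s. u s - c)"
  have mean_u': "pmf_mean p u' = pmf_mean p u - c" for p by (simp add: u'_def pmf_mean_diff)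
  \<comment> \<open>Centring turns the reward into \<open>\<rho> s - (1 - \<gamma>) * c\<close>, a
    difference of two numbers in \<open>[0, 3/2]\<close>.\<close>
  have u'_step: "\<bar>u' s - \<gamma> * pmf_mean (K s) u'\<bar> \<le> 3/2" for s
  proof -
    have "u' s - \<gamma> * pmf_mean (K s) u' = \<rho> s - (1 - \<gamma>) * c"
      unfolding mean_u' using u[of s] by (simp add: u'_def algebra_simps)
    moreover have "(1 - \<gamma>) * c \<le> 3/2"
    proof -
      have "(1 - \<gamma>) * c \<le> (1 - \<gamma>) * ((3/2) * H)" using c(2) g0 by (intro mult_left_mono) auto
      also have "\<dots> = (3/2) * (H * (1 - \<gamma>))" by simp
      finally show ?thesis unfolding H(2) by simp
    qed
    moreover have "0 \<le> (1 - \<gamma>) * c" using g0 c by simp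
    ultimately show ?thesis using rho[of s] by linarith
  qed
  have g4: "1/4 \<le> \<gamma>\<^sup>2" using power_mono[of "1/2" \<gamma> 2] gamma by (simp add: power2_eq_square)
  have quarter: "pmf_var p f / 4 \<le> \<gamma>\<^sup>2 * pmf_var p f" for p f
    using mult_right_mono[OF g4 pmf_var_nonneg[of p f]] by simp
  have var_u: "pmf_var (K s) u \<le> 4 * (\<gamma> * pmf_mean (K s) (\<lambda>s. (u' s)\<^sup>2) - (u' s)\<^sup>2 + 3/2 * D)" for s
  proof -
    have "\<gamma>\<^sup>2 * pmf_var (K s) u' \<le> \<gamma> * pmf_mean (K s) (\<lambda>s. (u' s)\<^sup>2) - (u' s)\<^sup>2 + 2 * (D/2) * (3/2)"
      by (rule discounted_var_le) (use g0 u'_step c(3) in \<open>auto simp: u'_def\<close>)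
    then show ?thesis using quarter[of "K s" u'] by (simp add: u'_def pmf_var_shift)
  qed
  have var_x: "pmf_var (K s) x \<le> 4 * (\<gamma> * pmf_mean (K s) (\<lambda>s. (x s)\<^sup>2) - (x s)\<^sup>2 + 2 * Y * \<bar>b s\<bar>)" for s
  proof -
    have "\<gamma>\<^sup>2 * pmf_var (K s) x \<le> \<gamma> * pmf_mean (K s) (\<lambda>s. (x s)\<^sup>2) - (x s)\<^sup>2 + 2 * Y * \<bar>b s\<bar>"
    proof (rule discounted_var_le[OF g0(1) g0(3) _ xY])
      show "\<bar>x s - \<gamma> * pmf_mean (K s) x\<bar> \<le> \<bar>b s\<bar>" using x[of s] by simp
    qed
    then show ?thesis using quarter[of "K s" x] by simp
  qed
  have osc_uh: "osc uh \<le> D + 2 * Y"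
    using osc_perturb_le[of uh u Y] xY D(1) by (force simp: x_def)
  have "Y \<le> H * (11 * a + 7 * e)"
  proof (cases "Y = 0")
    case True
    then show ?thesis using H(1) a(1) e by simp
  next
    case False
    with Y0 have Y: "0 < Y" by simp
    \<comment> \<open>Weights for \<open>amgm\<close>. \<open>\<mu>0\<close> balances, up to
      constants, \<open>6 * \<mu>0 * D * H\<close> against \<open>H * l / \<mu>0\<close>, both of
      order \<open>H * a\<close>; \<open>\<mu>1\<close> turns the term quadratic in \<open>Y\<close>
      into \<open>Y / 4\<close>. The division by \<open>Y\<close> is why \<open>Y = 0\<close> is
      split off.\<close>
    define \<mu>0 \<mu>1 where "\<mu>0 = a / (2 * D)" and "\<mu>1 = 1 / (32 * Y)"
    have lam: "0 < \<mu>0" "0 < \<mu>1" using a D Y by (auto simp: \<mu>0_def \<mu>1_def)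
    define C where "C = l / \<mu>0 + l / \<mu>1 + l * (D + 2 * Y) + 3 * e"
    have sqrt_l: "sqrt l \<le> 1/16"
      by (rule real_le_lsqrt) (use l g0 gamma in \<open>auto simp: power2_eq_square\<close>)
    have amgm: "2 * sqrt l * v \<le> k * v\<^sup>2 + l / k" if "0 < k" for k v
    proof -
      have "0 \<le> (k * v - sqrt l)\<^sup>2 / k" using that by simp
      also have "(k * v - sqrt l)\<^sup>2 / k = k * v\<^sup>2 + l / k - 2 * sqrt l * v"
        using that l(1) by (simp add: power2_diff power_mult_distrib divide_simps)
          (simp add: algebra_simps power2_eq_square)
      finally show ?thesis by simp
    qed
    have b_le: "\<bar>b s\<bar> \<le> \<mu>0 * pmf_var (K s) u + \<mu>1 * pmf_var (K s) x + C" for s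
    proof -
      have "\<bar>b s\<bar> \<le> \<bar>pmf_mean (Kh s) uh - pmf_mean (K s) uh\<bar>"
        using g0 by (simp add: b_def abs_mult mult_left_le_one_le)
      also have "\<dots> \<le> 2 * sqrt l * (pmf_sd (K s) uh + e) + l * (osc uh + 2 * e) + 2 * e"
        by (rule conc)
      also have "\<dots> \<le> 2 * sqrt l * (pmf_sd (K s) u + pmf_sd (K s) x + e) + l * (D + 2 * Y + 2 * e) + 2 * e"
      proof -
        have "pmf_sd (K s) uh \<le> pmf_sd (K s) u + pmf_sd (K s) x"
          using pmf_sd_add_le[of "K s" u x] by (simp add: x_def)
        then show ?thesis using osc_uh l by (intro add_mono mult_left_mono) auto
      qed
      also have "\<dots> = 2 * sqrt l * pmf_sd (K s) u + 2 * sqrt l * pmf_sd (K s) x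
           + (2 * sqrt l + 2 * l + 2) * e + l * (D + 2 * Y)"
        by (simp add: algebra_simps)
      also have "\<dots> \<le> (\<mu>0 * pmf_var (K s) u + l / \<mu>0) + (\<mu>1 * pmf_var (K s) x + l / \<mu>1)
           + 3 * e + l * (D + 2 * Y)"
      proof -
        have "2 * sqrt l + 2 * l + 2 \<le> 3" using sqrt_l l gamma by simp
        then show ?thesis
          using amgm[OF lam(1), of "pmf_sd (K s) u"] amgm[OF lam(2), of "pmf_sd (K s) x"]
            mult_right_mono[OF _ e, of _ 3]
          unfolding pmf_sd_power2 by (smt (verit))
      qed
      finally show ?thesis by (simp add: C_def)
    qed
    \<comment> \<open>A supersolution for \<open>\<bar>b\<bar>\<close>: applying
      \<open>I - \<gamma> K\<close> yields the right-hand sides of \<open>var_u\<close> and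
      \<open>var_x\<close>, weighted by \<open>\<mu>0\<close> and \<open>\<mu>1\<close>, plus
      \<open>C\<close>. The term with \<open>y\<close> supplies the \<open>\<bar>b s\<bar>\<close>
      in \<open>var_x\<close>.\<close>
    define z where "z = (\<lambda>s. (4 * \<mu>0) * ((3/2) * D * H - (u' s)\<^sup>2) + (4 * \<mu>1) * (2 * Y * y s - (x s)\<^sup>2) + C * H)"
    have z: "\<bar>b s\<bar> + \<gamma> * pmf_mean (K s) z \<le> z s" for s
    proof -
      have mz: "pmf_mean (K s) z = (4 * \<mu>0) * ((3/2) * D * H - pmf_mean (K s) (\<lambda>s. (u' s)\<^sup>2))
          + (4 * \<mu>1) * (2 * Y * pmf_mean (K s) y - pmf_mean (K s) (\<lambda>s. (x s)\<^sup>2)) + C * H"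
        unfolding z_def by (simp only: pmf_mean_add pmf_mean_diff pmf_mean_cmult pmf_mean_const)
      have zs: "z s = (4 * \<mu>0) * ((3/2) * D * H - (u' s)\<^sup>2) + (4 * \<mu>1) * (2 * Y * y s - (x s)\<^sup>2) + C * H"
        by (simp add: z_def)
      have "z s - \<gamma> * pmf_mean (K s) z =
          \<mu>0 * (4 * (\<gamma> * pmf_mean (K s) (\<lambda>s. (u' s)\<^sup>2) - (u' s)\<^sup>2 + 3/2 * D * (H * (1 - \<gamma>))))
        + \<mu>1 * (4 * (\<gamma> * pmf_mean (K s) (\<lambda>s. (x s)\<^sup>2) - (x s)\<^sup>2 + 2 * Y * (y s - \<gamma> * pmf_mean (K s) y)))
        + C * (H * (1 - \<gamma>))"
        unfolding zs mz by (simp add: field_simps)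
      also have "y s - \<gamma> * pmf_mean (K s) y = \<bar>b s\<bar>" using y[of s] by simp
      also have "\<mu>0 * (4 * (\<gamma> * pmf_mean (K s) (\<lambda>s. (u' s)\<^sup>2) - (u' s)\<^sup>2 + 3/2 * D * (H * (1 - \<gamma>))))
        + \<mu>1 * (4 * (\<gamma> * pmf_mean (K s) (\<lambda>s. (x s)\<^sup>2) - (x s)\<^sup>2 + 2 * Y * \<bar>b s\<bar>))
        + C * (H * (1 - \<gamma>)) \<ge> \<mu>0 * pmf_var (K s) u + \<mu>1 * pmf_var (K s) x + C"
        unfolding H(2) mult_1_right
        using var_u[of s] var_x[of s] lam by (intro add_mono mult_left_mono) auto
      finally show ?thesis using b_le[of s] by linarith
    qed
    have "Y \<le> z s0"
      unfolding s0 y_def by (rule resolvent_le) (use gamma z in auto)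
    also have "\<dots> \<le> (4 * \<mu>0) * ((3/2) * D * H) + (4 * \<mu>1) * (2 * Y * Y) + C * H"
      unfolding z_def s0[symmetric] using lam by (intro add_mono mult_left_mono order_refl) auto
    also have "(4 * \<mu>0) * ((3/2) * D * H) = 3 * (H * a)" using D by (simp add: \<mu>0_def)
    also have "(4 * \<mu>1) * (2 * Y * Y) = Y / 4" using Y by (simp add: \<mu>1_def)
    also have "C * H = 2 * (H * a) + (H * l) * (32 * Y) + H * a\<^sup>2 + (H * l) * (2 * Y) + 3 * (H * e)"
    proof -
      have "l / \<mu>0 = 2 * a" using a D by (simp add: \<mu>0_def field_simps power2_eq_square)
      moreover have "l / \<mu>1 = l * (32 * Y)" by (simp add: \<mu>1_def)
      ultimately show ?thesis unfolding C_def a(2) by (simp add: algebra_simps)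
    qed
    also have "(H * l) * (32 * Y) \<le> Y / 4" using mult_right_mono[OF H(3), of Y] Y by simp
    also have "(H * l) * (2 * Y) \<le> Y / 64" using mult_right_mono[OF H(3), of Y] Y by simp
    also have "H * a\<^sup>2 \<le> 0.11 * (H * a)"
      using mult_left_mono[OF a_small, of "H * a"] H(1) a(1) by (simp add: power2_eq_square)
    \<comment> \<open>The coefficient is \<open>1 - 1/4 - 1/4 - 1/64\<close>; dividing by it turns
      5.11 and 3 into less than 11 and 7.\<close>
    finally have "Y * (31/64) \<le> 5.11 * (H * a) + 3 * (H * e)" by simp
    moreover have "0 \<le> H * a" "0 \<le> H * e" using H a e by auto
    ultimately have "Y \<le> 11 * (H * a) + 7 * (H * e)" by simp
    then show ?thesis by (simp add: algebra_simps)
  qed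
  then show ?thesis using xY[of s] by (simp add: x_def H_def a_def)
qed

section \<open>Bernstein's inequality for empirical means\<close>

text \<open>For \<open>x = - y < 0\<close>, invert the quadratic Taylor lower bound for
  \<open>exp y\<close>; its product with \<open>1 - y + y^2\<close> is at least 1.\<close>

lemma exp_le_quadratic:
  fixes x :: real
  assumes "\<bar>x\<bar> \<le> 1"
  shows "exp x \<le> 1 + x + x\<^sup>2"
proof (cases "0 \<le> x")
  case True
  then show ?thesis using assms exp_bound[of x] by simp
next
  case False
  define y where "y = - x"
  have y: "0 \<le> y" using False by (simp add: y_def)
  have pos: "0 < 1 + y + y\<^sup>2 / 2" using y by (simp add: add_pos_nonneg)
  have "1 \<le> 1 + (y\<^sup>2 + y ^ 3 + y ^ 4) / 2" using y by simp
  also have "\<dots> = (1 - y + y\<^sup>2) * (1 + y + y\<^sup>2 / 2)"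
    by (simp add: field_simps power2_eq_square power3_eq_cube power4_eq_xxxx)
  finally have 1: "inverse (1 + y + y\<^sup>2 / 2) \<le> 1 - y + y\<^sup>2"
    using pos by (simp add: field_simps)
  have "exp x = inverse (exp y)" by (simp add: y_def exp_minus)
  also have "\<dots> \<le> inverse (1 + y + y\<^sup>2 / 2)"
    using exp_lower_Taylor_quadratic[OF y] pos by (rule le_imp_inverse_le)
  also note 1
  finally show ?thesis by (simp add: y_def)
qed

lemma nn_integral_pmf_mean:
  fixes p :: "'s::finite pmf"
  assumes "\<And>s. 0 \<le> f s"
  shows "(\<integral>\<^sup>+s. ennreal (f s) \<partial>measure_pmf p) = ennreal (pmf_mean p f)"
proof -
  have "(\<integral>\<^sup>+s. ennreal (f s) \<partial>measure_pmf p) = (\<Sum>s\<in>UNIV. ennreal (f s) * ennreal (pmf p s))"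
    by (rule nn_integral_measure_pmf_support) auto
  also have "\<dots> = ennreal (pmf_mean p f)"
    using assms by (simp add: pmf_mean_def sum_ennreal flip: ennreal_mult) (simp add: mult.commute)
  finally show ?thesis .
qed

text \<open>For \<open>n = 0\<close> this is the junk value of \<open>pmf_of_set {}\<close>.\<close>

definition sample_pmf :: "nat \<Rightarrow> (nat \<Rightarrow> 's) \<Rightarrow> 's pmf" where
  "sample_pmf n y = map_pmf y (pmf_of_set {..<n})"

lemma pmf_mean_sample_pmf:
  assumes "0 < n"
  shows "pmf_mean (sample_pmf n y) f = (\<Sum>i<n. f (y i)) / real n"
proof -
  have "pmf_mean p f = measure_pmf.expectation p f" for p
    unfolding pmf_mean_def by (subst integral_measure_pmf_real[of UNIV]) (auto simp: mult.commute)
  then show ?thesis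
    using assms by (subst \<open>\<And>p. pmf_mean p f = _\<close>)
      (simp add: sample_pmf_def integral_pmf_of_set lessThan_empty_iff)
qed

lemma product_sigma_finite_pmf: "product_sigma_finite (\<lambda>i. measure_pmf (p i))"
  by (simp add: product_sigma_finite_def measure_pmf.sigma_finite_measure_axioms)

text \<open>A finite product of finite discrete spaces has finitely many points, each a measurable
  box. Hence every event in the samples alone is measurable.\<close>

lemma sets_PiM_finite_discrete:
  assumes I: "finite I" and "\<And>i. i \<in> I \<Longrightarrow> finite (space (M i))"
    and "\<And>i x. i \<in> I \<Longrightarrow> x \<in> space (M i) \<Longrightarrow> {x} \<in> sets (M i)"
    and A: "A \<subseteq> space (PiM I M)"
  shows "A \<in> sets (PiM I M)"
proof -
  have "finite (space (PiM I M))" unfolding space_PiM using assms by (intro finite_PiE) auto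
  then have "finite A" using A by (rule finite_subset[rotated])
  moreover have "{x} \<in> sets (PiM I M)" if "x \<in> A" for x
  proof -
    have x: "x \<in> PiE I (\<lambda>i. space (M i))" using that A by (auto simp: space_PiM)
    then have "{x} = PiE I (\<lambda>i. {x i})"
      by (metis PiE_iff PiE_singleton)
    also have "\<dots> \<in> sets (PiM I M)" using assms(1,3) x by (intro sets_PiM_I_finite) (auto simp: PiE_iff)
    finally show ?thesis .
  qed
  ultimately show ?thesis
    by (metis (no_types, lifting) UN_singleton sets.finite_UN)
qed

lemma space_PiM_pmf:
  fixes n :: nat
  shows "space (PiM {..<n} (\<lambda>_. measure_pmf p)) = PiE {..<n} (\<lambda>_. UNIV)"
  by (simp add: space_PiM)

lemma sets_PiM_pmf [simp]:
  fixes p :: "'s::finite pmf" and n :: nat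
  assumes "A \<subseteq> PiE {..<n} (\<lambda>_. UNIV)"
  shows "A \<in> sets (PiM {..<n} (\<lambda>_. measure_pmf p))"
  using assms by (intro sets_PiM_finite_discrete) (auto simp: space_PiM_pmf finite_lessThan)

text \<open>Since \<open>g\<close> is centred, \<open>exp_le_quadratic\<close> bounds each moment
  generating function by the exponential of \<open>\<mu>^2\<close> times the second moment;
  independence multiplies these bounds and Markov's inequality concludes.\<close>

lemma chernoff_sample:
  fixes p :: "'s::finite pmf" and n :: nat
  assumes mean: "pmf_mean p g = 0" and bound: "\<And>s. \<bar>\<mu> * g s\<bar> \<le> 1" and "0 < \<mu>"
  defines "M \<equiv> PiM {..<n} (\<lambda>_. measure_pmf p)"
  shows "emeasure M {y \<in> space M. a \<le> (\<Sum>i<n. g (y i))}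
      \<le> ennreal (exp (real n * (\<mu>\<^sup>2 * pmf_mean p (\<lambda>s. (g s)\<^sup>2)) - \<mu> * a))"
proof -
  let ?V = "pmf_mean p (\<lambda>s. (g s)\<^sup>2)"
  interpret product_sigma_finite "\<lambda>i::nat. measure_pmf p" by (rule product_sigma_finite_pmf)
  have meas: "f \<in> borel_measurable M" for f :: "_ \<Rightarrow> real"
    unfolding M_def by (rule borel_measurableI) (auto simp: space_PiM_pmf)
  have "pmf_mean p (\<lambda>s. exp (\<mu> * g s)) \<le> pmf_mean p (\<lambda>s. 1 + \<mu> * g s + \<mu>\<^sup>2 * (g s)\<^sup>2)"
    by (rule pmf_mean_mono) (use exp_le_quadratic[OF bound] in \<open>simp add: power_mult_distrib\<close>)
  also have "\<dots> = 1 + \<mu>\<^sup>2 * ?V" by (simp add: pmf_mean_add pmf_mean_cmult mean)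
  also have "\<dots> \<le> exp (\<mu>\<^sup>2 * ?V)" by simp
  finally have mgf: "(\<integral>\<^sup>+s. ennreal (exp (\<mu> * g s)) \<partial>measure_pmf p) \<le> ennreal (exp (\<mu>\<^sup>2 * ?V))"
    by (simp add: nn_integral_pmf_mean ennreal_leI)
  have "(\<integral>\<^sup>+y. ennreal (exp (\<mu> * (\<Sum>i<n. g (y i)))) * indicator (space M) y \<partial>M)
      = (\<integral>\<^sup>+y. (\<Prod>i<n. ennreal (exp (\<mu> * g (y i)))) \<partial>M)"
    by (intro nn_integral_cong) (simp add: sum_distrib_left exp_sum prod_ennreal)
  also have "\<dots> = (\<Prod>i<n. \<integral>\<^sup>+s. ennreal (exp (\<mu> * g s)) \<partial>measure_pmf p)"
    unfolding M_def by (rule product_nn_integral_prod) auto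
  also have "\<dots> \<le> (\<Prod>i<n. ennreal (exp (\<mu>\<^sup>2 * ?V)))"
    by (rule prod_mono_ennreal) (rule mgf)
  also have "\<dots> = ennreal (exp (real n * (\<mu>\<^sup>2 * ?V)))"
    by (simp add: prod_ennreal ennreal_power flip: exp_of_nat_mult)
  finally have prod: "(\<integral>\<^sup>+y. ennreal (exp (\<mu> * (\<Sum>i<n. g (y i)))) * indicator (space M) y \<partial>M)
      \<le> ennreal (exp (real n * (\<mu>\<^sup>2 * ?V)))" .
  have "emeasure M {y \<in> space M. a \<le> (\<Sum>i<n. g (y i))}
      \<le> ennreal (exp (- \<mu> * a)) * (\<integral>\<^sup>+y. ennreal (exp (\<mu> * (\<Sum>i<n. g (y i)))) * indicator (space M) y \<partial>M)"
    by (rule Chernoff_ineq_nn_integral_ge) (use \<open>0 < \<mu>\<close> meas in auto)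
  also have "\<dots> \<le> ennreal (exp (- \<mu> * a)) * ennreal (exp (real n * (\<mu>\<^sup>2 * ?V)))"
    by (rule mult_left_mono[OF prod]) simp
  also have "\<dots> = ennreal (exp (real n * (\<mu>\<^sup>2 * ?V) - \<mu> * a))"
    by (simp add: mult_exp_exp flip: ennreal_mult)
  finally show ?thesis .
qed

text \<open>Chernoff's bound at \<open>k = min (sqrt l / \<sigma>) (1 / B)\<close>. If the first
  value is the smaller one, the summand \<open>2 * sqrt l * \<sigma>\<close> alone brings the
  exponent to \<open>- L\<close>. Otherwise, which includes \<open>\<sigma> = 0\<close>, the summand
  \<open>l * B\<close> supplies \<open>- L\<close> and the other one only offsets the
  variance.\<close>

lemma bernstein_one_sided:
  fixes p :: "'s::finite pmf"
  assumes n: "0 < n" and L: "0 < L" and B: "0 < B"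
    and mean: "pmf_mean p g = 0" and bound: "\<And>s. \<bar>g s\<bar> \<le> B"
    and V: "pmf_mean p (\<lambda>s. (g s)\<^sup>2) = \<sigma>\<^sup>2" "0 \<le> \<sigma>"
  defines "M \<equiv> PiM {..<n} (\<lambda>_. measure_pmf p)"
  shows "emeasure M {y \<in> space M. real n * (2 * sqrt (L / n) * \<sigma> + L / n * B) \<le> (\<Sum>i<n. g (y i))}
      \<le> ennreal (exp (- L))"
proof -
  define l where "l = L / real n"
  have l: "0 < l" "real n * l = L" "(sqrt l)\<^sup>2 = l" using n L by (auto simp: l_def)
  define \<tau> where "\<tau> = 2 * sqrt l * \<sigma> + l * B"
  have "\<exists>k>0. k * B \<le> 1 \<and> k\<^sup>2 * \<sigma>\<^sup>2 - k * \<tau> \<le> - l"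
  proof (cases "B * sqrt l \<le> \<sigma>")
    case True
    then have s: "0 < \<sigma>" using B l by (smt (verit) mult_pos_pos real_sqrt_gt_zero)
    define k where "k = sqrt l / \<sigma>"
    have k: "0 < k" "k * \<sigma> = sqrt l" using s l by (auto simp: k_def)
    have "k * \<tau> = 2 * sqrt l * (k * \<sigma>) + k * (l * B)" by (simp add: \<tau>_def algebra_simps)
    also have "\<dots> = 2 * l + k * (l * B)" using l by (simp add: k power2_eq_square)
    also have "\<dots> \<ge> 2 * l" using k l B by simp
    finally have "k * \<tau> \<ge> 2 * l" .
    moreover have "k\<^sup>2 * \<sigma>\<^sup>2 = l" by (simp add: k l flip: power_mult_distrib)
    moreover have "k * B \<le> 1" using True s by (simp add: k_def field_simps)
    ultimately show ?thesis using k by (intro exI[of _ k]) auto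
  next
    case False
    define t where "t = \<sigma> / B"
    have t: "0 \<le> t" "t \<le> sqrt l" using False B V by (auto simp: t_def field_simps)
    have "(1 / B)\<^sup>2 * \<sigma>\<^sup>2 - 1 / B * \<tau> = t * (t - 2 * sqrt l) - l"
      using B by (simp add: t_def \<tau>_def field_simps power2_eq_square)
    also have "t * (t - 2 * sqrt l) \<le> 0" using t l by (intro mult_nonneg_nonpos) auto
    finally show ?thesis using B by (intro exI[of _ "1 / B"]) auto
  qed
  then obtain k where k: "0 < k" "k * B \<le> 1" "k\<^sup>2 * \<sigma>\<^sup>2 - k * \<tau> \<le> - l" by blast
  have "emeasure M {y \<in> space M. real n * \<tau> \<le> (\<Sum>i<n. g (y i))}
      \<le> ennreal (exp (real n * (k\<^sup>2 * pmf_mean p (\<lambda>s. (g s)\<^sup>2)) - k * (real n * \<tau>)))"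
    unfolding M_def
  proof (rule chernoff_sample[OF mean _ k(1)])
    show "\<bar>k * g s\<bar> \<le> 1" for s
      using mult_left_mono[OF bound[of s], of k] k(1,2) unfolding abs_mult by linarith
  qed
  also have "\<dots> \<le> ennreal (exp (- L))"
    using mult_left_mono[OF k(3), of "real n"] l by (intro ennreal_leI) (simp add: V algebra_simps)
  finally show ?thesis by (simp add: \<tau>_def l_def)
qed

text \<open>\<open>osc f\<close> serves as the uniform bound on the centred function in both tails.
  A constant \<open>f\<close> is separated because that bound must be positive.\<close>

lemma bernstein_sample_pmf:
  fixes p :: "'s::finite pmf"
  assumes n: "0 < n" and L: "0 < L"
  defines "M \<equiv> PiM {..<n} (\<lambda>_. measure_pmf p)"
  shows "emeasure M {y \<in> space M. \<not> \<bar>pmf_mean (sample_pmf n y) f - pmf_mean p f\<bar>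
             \<le> 2 * sqrt (L / n) * pmf_sd p f + L / n * osc f}
      \<le> ennreal (2 * exp (- L))"
proof (cases "osc f = 0")
  case True
  have "f s = f undefined" for s using osc_ge[of f s undefined] osc_ge[of f undefined s] True by simp
  then have f: "f = (\<lambda>_. f undefined)" by auto
  have "pmf_mean q f = f undefined" for q by (subst f) simp
  then show ?thesis using n L by (simp add: osc_nonneg)
next
  case False
  then have B: "0 < osc f" using osc_nonneg[of f] by simp
  let ?t = "2 * sqrt (L / n) * pmf_sd p f + L / n * osc f"
  let ?g = "\<lambda>s. f s - pmf_mean p f"
  let ?A = "\<lambda>g. {y \<in> space M. real n * ?t \<le> (\<Sum>i<n. g (y i))}"
  have 1: "emeasure M (?A ?g) \<le> ennreal (exp (- L))" unfolding M_def
    by (rule bernstein_one_sided[OF n L B]) (simp_all add: pmf_mean_diff osc_dist_mean_le pmf_sd_power2 pmf_var_def)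
  have 2: "emeasure M (?A (\<lambda>s. - ?g s)) \<le> ennreal (exp (- L))" unfolding M_def
    by (rule bernstein_one_sided[OF n L B])
      (use osc_dist_mean_le[of f _ p] in \<open>simp_all add: pmf_mean_diff pmf_sd_power2 pmf_var_def power2_commute abs_minus_commute\<close>)
  have "{y \<in> space M. \<not> \<bar>pmf_mean (sample_pmf n y) f - pmf_mean p f\<bar> \<le> ?t} \<subseteq> ?A ?g \<union> ?A (\<lambda>s. - ?g s)"
  proof
    fix y assume "y \<in> {y \<in> space M. \<not> \<bar>pmf_mean (sample_pmf n y) f - pmf_mean p f\<bar> \<le> ?t}"
    then have y: "y \<in> space M" "?t \<le> \<bar>pmf_mean (sample_pmf n y) f - pmf_mean p f\<bar>" by auto
    have *: "(\<Sum>i<n. ?g (y i)) = real n * (pmf_mean (sample_pmf n y) f - pmf_mean p f)"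
      using n by (simp add: pmf_mean_sample_pmf sum_subtractf field_simps)
    have "(\<Sum>i<n. - ?g (y i)) = - (\<Sum>i<n. ?g (y i))" by (rule sum_negf)
    then have **: "(\<Sum>i<n. - ?g (y i)) = real n * (- (pmf_mean (sample_pmf n y) f - pmf_mean p f))"
      unfolding * by (simp only: mult_minus_right)
    show "y \<in> ?A ?g \<union> ?A (\<lambda>s. - ?g s)"
    proof (cases "0 \<le> pmf_mean (sample_pmf n y) f - pmf_mean p f")
      case True
      then have "y \<in> ?A ?g" using y unfolding mem_Collect_eq * by (intro conjI mult_left_mono) auto
      then show ?thesis by blast
    next
      case False
      then have "y \<in> ?A (\<lambda>s. - ?g s)" using y unfolding mem_Collect_eq ** by (intro conjI mult_left_mono) auto
      then show ?thesis by blast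
    qed
  qed
  then have "emeasure M {y \<in> space M. \<not> \<bar>pmf_mean (sample_pmf n y) f - pmf_mean p f\<bar> \<le> ?t}
      \<le> emeasure M (?A ?g \<union> ?A (\<lambda>s. - ?g s))"
    by (rule emeasure_mono) (auto simp: M_def space_PiM_pmf)
  also have "\<dots> \<le> emeasure M (?A ?g) + emeasure M (?A (\<lambda>s. - ?g s))"
    by (rule emeasure_subadditive) (auto simp: M_def space_PiM_pmf)
  also have "\<dots> \<le> ennreal (exp (- L)) + ennreal (exp (- L))" by (intro add_mono 1 2)
  also have "\<dots> = ennreal (2 * exp (- L))" by (simp flip: ennreal_plus)
  finally show ?thesis .
qed

section \<open>Minorization and oscillation\<close>

abbreviation kernel_op :: "('s::finite \<Rightarrow> 's pmf) \<Rightarrow> ('s \<Rightarrow> real) \<Rightarrow> 's \<Rightarrow> real" where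
  "kernel_op K f \<equiv> (\<lambda>s. pmf_mean (K s) f)"

lemma osc_add_le: "osc (\<lambda>s. f s + g s) \<le> osc f + osc g"
proof (rule osc_le)
  fix s s'
  show "f s + g s - (f s' + g s') \<le> osc f + osc g"
    using osc_ge[of f s s'] osc_ge[of g s s'] by linarith
qed

lemma osc_cmult_le:
  assumes "0 \<le> c" "c \<le> 1"
  shows "osc (\<lambda>s. c * f s) \<le> osc f"
proof (rule osc_le)
  fix s s'
  have "c * f s - c * f s' = c * (f s - f s')" by (simp add: algebra_simps)
  also have "\<dots> \<le> c * osc f" using assms osc_ge by (intro mult_left_mono) auto
  also have "\<dots> \<le> osc f" using mult_right_mono[OF assms(2) osc_nonneg[of f]] by simp
  finally show "c * f s - c * f s' \<le> osc f" .
qed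

lemma osc_kernel_op_le: "osc (kernel_op K f) \<le> osc f"
proof (rule osc_le)
  fix s s'
  have "pmf_mean (K s) f \<le> Max (range f)" "Min (range f) \<le> pmf_mean (K s') f"
    by (auto intro!: pmf_mean_le pmf_mean_ge)
  then show "pmf_mean (K s) f - pmf_mean (K s') f \<le> osc f" unfolding osc_def by linarith
qed

text \<open>Minorization is stated for matrix powers; iterated averaging is the form in which
  oscillations are tracked.\<close>

lemma mat_pow_trans_mat:
  "(mat_pow (trans_mat P pol) m *v (\<chi> s. f s)) $ s = (kernel_op (\<lambda>s. P s (pol s)) ^^ m) f s"
proof (induction m arbitrary: s)
  case (Suc m)
  have "mat_pow (trans_mat P pol) m *v (\<chi> s. f s) = (\<chi> s. (kernel_op (\<lambda>s. P s (pol s)) ^^ m) f s)"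
    by (simp add: vec_eq_iff Suc.IH)
  then show ?case
    by (simp flip: matrix_vector_mul_assoc)
      (simp add: matrix_vector_mult_def trans_mat_def pmf_mean_def)
qed simp

text \<open>Doeblin's argument: after removing \<open>q * pmf \<psi>\<close> from each row of the
  \<open>m\<close>-step matrix, the nonnegative rest has row sums \<open>1 - q\<close>, and the
  removed part contributes the same number from every state.\<close>

lemma osc_minorized_le:
  assumes min: "minorizes (trans_mat P pol) m q \<psi>"
  shows "osc ((kernel_op (\<lambda>s. P s (pol s)) ^^ m) f) \<le> (1 - q) * osc f"
proof (rule osc_le)
  fix s s'
  let ?K = "\<lambda>s. P s (pol s)"
  define w where "w = (\<lambda>s t. mat_pow (trans_mat P pol) m $ s $ t - q * pmf \<psi> t)"
  have w0: "0 \<le> w s t" for s t using min by (simp add: w_def minorizes_def)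
  have apply_eq: "(kernel_op ?K ^^ m) g s = (\<Sum>t\<in>UNIV. w s t * g t) + q * pmf_mean \<psi> g" for g s
    by (subst mat_pow_trans_mat[symmetric])
      (simp add: w_def matrix_vector_mult_def pmf_mean_def algebra_simps sum_subtractf sum_distrib_left)
  have "(kernel_op ?K ^^ k) (\<lambda>_. 1) = (\<lambda>_. 1)" for k by (induction k) auto
  with apply_eq[of "\<lambda>_. 1"] have w1: "(\<Sum>t\<in>UNIV. w s t) = 1 - q" for s by (simp add: algebra_simps)
  have "(\<Sum>t\<in>UNIV. w s t * f t) \<le> (\<Sum>t\<in>UNIV. w s t * Max (range f))"
    by (intro sum_mono mult_left_mono w0) auto
  moreover have "(\<Sum>t\<in>UNIV. w s' t * f t) \<ge> (\<Sum>t\<in>UNIV. w s' t * Min (range f))"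
    by (intro sum_mono mult_left_mono w0) auto
  ultimately show "(kernel_op ?K ^^ m) f s - (kernel_op ?K ^^ m) f s' \<le> (1 - q) * osc f"
    unfolding apply_eq osc_def right_diff_distrib by (simp add: w1 flip: sum_distrib_right)
qed

text \<open>Unroll the equation \<open>m\<close> times: each step adds at most \<open>c\<close> to
  the oscillation and the remainder contracts by \<open>1 - q\<close>, so
  \<open>osc u \<le> m * c + (1 - q) * osc u\<close>. No factor \<open>1 / (1 - \<gamma>)\<close>
  appears.\<close>

lemma osc_discounted_le:
  fixes P :: "'s::finite \<Rightarrow> 'a \<Rightarrow> 's pmf"
  assumes g: "0 \<le> \<gamma>" "\<gamma> < 1"
    and u: "\<And>s. u s = \<rho> s + \<gamma> * pmf_mean (P s (pol s)) u"
    and \<rho>: "osc \<rho> \<le> c"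
    and min: "minorizes (trans_mat P pol) m q \<psi>" "0 < q"
  shows "osc u \<le> c * (real m / q)"
proof -
  let ?K = "\<lambda>s. P s (pol s)"
  have "\<exists>g. u = (\<lambda>s. g s + \<gamma> ^ k * (kernel_op ?K ^^ k) u s) \<and> osc g \<le> real k * c" for k
  proof (induction k)
    case 0
    have "osc (\<lambda>_::'s. 0) \<le> real 0 * c" by (rule osc_le) simp
    then show ?case by (intro exI[of _ "\<lambda>_. 0"]) simp
  next
    case (Suc k)
    then obtain g where g_eq: "u = (\<lambda>s. g s + \<gamma> ^ k * (kernel_op ?K ^^ k) u s)"
      and g_osc: "osc g \<le> real k * c" by blast
    define h where "h = (\<lambda>s. \<rho> s + \<gamma> * pmf_mean (?K s) g)"
    have "u s = h s + \<gamma> ^ Suc k * (kernel_op ?K ^^ Suc k) u s" for s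
    proof -
      have "u s = \<rho> s + \<gamma> * pmf_mean (?K s) (\<lambda>s. g s + \<gamma> ^ k * (kernel_op ?K ^^ k) u s)"
        using u[of s] g_eq by simp
      then show ?thesis by (simp add: h_def pmf_mean_add pmf_mean_cmult algebra_simps)
    qed
    then have "u = (\<lambda>s. h s + \<gamma> ^ Suc k * (kernel_op ?K ^^ Suc k) u s)" by (rule ext)
    moreover have "osc h \<le> osc \<rho> + osc (\<lambda>s. \<gamma> * pmf_mean (?K s) g)" unfolding h_def by (rule osc_add_le)
    moreover have "osc (\<lambda>s. \<gamma> * pmf_mean (?K s) g) \<le> osc g"
      using osc_cmult_le[of \<gamma> "kernel_op ?K g"] osc_kernel_op_le[of ?K g] g by linarith
    ultimately show ?case using \<rho> g_osc by (intro exI[of _ h] conjI) (assumption, simp add: algebra_simps)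
  qed
  then obtain h where h: "u = (\<lambda>s. h s + \<gamma> ^ m * (kernel_op ?K ^^ m) u s)" "osc h \<le> real m * c" by blast
  have "osc u \<le> osc h + osc (\<lambda>s. \<gamma> ^ m * (kernel_op ?K ^^ m) u s)"
    by (subst h(1)) (rule osc_add_le)
  also have "osc (\<lambda>s. \<gamma> ^ m * (kernel_op ?K ^^ m) u s) \<le> osc ((kernel_op ?K ^^ m) u)"
    using g by (intro osc_cmult_le) (auto intro: power_le_one)
  also have "\<dots> \<le> (1 - q) * osc u" by (rule osc_minorized_le[OF min(1)])
  finally show ?thesis using h(2) min(2) by (simp add: field_simps)
qed

section \<open>The minorization time as an infimum\<close>

lemma t_minorize_pol_le: "t_minorize_pol P pol \<le> t_minorize P"
  unfolding t_minorize_def by (rule Max_ge) auto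

text \<open>Ergodicity makes the set under \<open>Inf\<close> nonempty, as a greatest lower bound in
  the reals requires.\<close>

lemma t_minorize_pol_greatest:
  assumes "uniformly_ergodic P"
    and "\<And>m q \<psi>. m \<ge> 1 \<Longrightarrow> 0 < q \<Longrightarrow> q \<le> 1 \<Longrightarrow> minorizes (trans_mat P pol) m q \<psi> \<Longrightarrow> x \<le> real m / q"
  shows "x \<le> t_minorize_pol P pol"
  unfolding t_minorize_pol_def
proof (rule cInf_greatest)
  show "{real m / q |m q. 1 \<le> m \<and> 0 < q \<and> q \<le> 1 \<and> (\<exists>\<psi>. minorizes (trans_mat P pol) m q \<psi>)} \<noteq> {}"
    using assms(1) unfolding uniformly_ergodic_def by blast
qed (use assms(2) in auto)

lemma t_minorize_ge_1:
  fixes P :: "'s::finite \<Rightarrow> 'a::finite \<Rightarrow> 's pmf"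
  assumes "uniformly_ergodic P"
  shows "1 \<le> t_minorize P"
proof -
  have "1 \<le> t_minorize_pol P (\<lambda>_. undefined)"
    by (rule t_minorize_pol_greatest[OF assms]) (auto simp: field_simps)
  then show ?thesis using t_minorize_pol_le order_trans by blast
qed

text \<open>Each minorization bounds \<open>?o / c\<close> by \<open>m / q\<close>, so the infimum
  inherits the bound whether or not it is attained.\<close>

lemma osc_resolvent_le:
  fixes P :: "'s::finite \<Rightarrow> 'a::finite \<Rightarrow> 's pmf"
  assumes "uniformly_ergodic P" "0 \<le> \<gamma>" "\<gamma> < 1" "osc \<rho> \<le> c" "0 < c"
  shows "osc (resolvent \<gamma> (\<lambda>s. P s (pol s)) \<rho>) \<le> c * t_minorize P"
proof -
  let ?o = "osc (resolvent \<gamma> (\<lambda>s. P s (pol s)) \<rho>)"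
  have "?o / c \<le> t_minorize_pol P pol"
  proof (rule t_minorize_pol_greatest[OF assms(1)])
    fix m :: nat and q \<psi> assume "0 < q" "minorizes (trans_mat P pol) m q \<psi>"
    from osc_discounted_le[OF assms(2,3) resolvent_eq[OF assms(2,3)] assms(4) this(2,1)] assms(5)
    show "?o / c \<le> real m / q" by (simp add: field_simps)
  qed
  also note t_minorize_pol_le
  finally show ?thesis using assms(5) by (simp add: field_simps)
qed

section \<open>Bellman operators\<close>

text \<open>The sets \<open>A s\<close> make policy evaluation (singletons) and full optimization
  (\<open>UNIV\<close>) instances of one operator.\<close>

definition bellman :: "real \<Rightarrow> ('s::finite \<Rightarrow> 'a::finite \<Rightarrow> real) \<Rightarrow> ('s \<Rightarrow> 'a \<Rightarrow> 's pmf)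
    \<Rightarrow> ('s \<Rightarrow> 'a set) \<Rightarrow> ('s \<Rightarrow> real) \<Rightarrow> 's \<Rightarrow> real" where
  "bellman \<gamma> R p A v s = Max ((\<lambda>a. R s a + \<gamma> * pmf_mean (p s a) v) ` A s)"

lemma bellman_le:
  assumes "A s \<noteq> {}" "\<And>a. a \<in> A s \<Longrightarrow> R s a + \<gamma> * pmf_mean (p s a) v \<le> x"
  shows "bellman \<gamma> R p A v s \<le> x"
  unfolding bellman_def by (rule Max.boundedI) (use assms in auto)

lemma bellman_ge: "a \<in> A s \<Longrightarrow> R s a + \<gamma> * pmf_mean (p s a) v \<le> bellman \<gamma> R p A v s"
  unfolding bellman_def by (rule Max_ge) auto

lemma bellman_contraction:
  assumes "0 \<le> \<gamma>" "A s \<noteq> {}" "\<And>t. \<bar>v t - w t\<bar> \<le> e"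
  shows "\<bar>bellman \<gamma> R p A v s - bellman \<gamma> R p A w s\<bar> \<le> \<gamma> * e"
proof -
  have *: "bellman \<gamma> R p A f s \<le> bellman \<gamma> R p A g s + \<gamma> * e" if "\<And>t. \<bar>f t - g t\<bar> \<le> e" for f g
  proof (rule bellman_le)
    show "A s \<noteq> {}" by (rule assms(2))
  next
    fix a assume a: "a \<in> A s"
    have "\<gamma> * (pmf_mean (p s a) f - pmf_mean (p s a) g) \<le> \<gamma> * e"
      using pmf_mean_abs_diff_le[of f g e "p s a"] that assms(1) by (intro mult_left_mono) auto
    then show "R s a + \<gamma> * pmf_mean (p s a) f \<le> bellman \<gamma> R p A g s + \<gamma> * e"
      using bellman_ge[where A=A and s=s, OF a, of R \<gamma> p g] by (simp add: algebra_simps)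
  qed
  from *[of v w] *[of w v] assms(3) show ?thesis by (auto simp: abs_minus_commute abs_le_iff)
qed

lemma bellman_fixed_point_unique:
  assumes g: "0 \<le> \<gamma>" "\<gamma> < 1" and A: "\<And>s. A s \<noteq> {}"
    and v: "v = bellman \<gamma> R p A v" and w: "w = bellman \<gamma> R p A w"
  shows "v = w"
proof -
  define d where "d = Max (range (\<lambda>s. \<bar>v s - w s\<bar>))"
  have d: "\<bar>v s - w s\<bar> \<le> d" for s unfolding d_def by simp
  have "d \<in> range (\<lambda>s. \<bar>v s - w s\<bar>)" unfolding d_def by (rule Max_in) auto
  then obtain s where "d = \<bar>v s - w s\<bar>" unfolding image_iff by blast
  also have "\<dots> \<le> \<gamma> * d"
    using bellman_contraction[where A=A and s=s and v=v and w=w, OF g(1) A d, of R p] by (simp flip: v w)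
  finally have "(1 - \<gamma>) * d \<le> 0" by (simp add: algebra_simps)
  then have "d \<le> 0" using g by (simp add: mult_le_0_iff)
  with d have "\<bar>v s - w s\<bar> \<le> 0" for s using order_trans by blast
  then show ?thesis by (intro ext) simp
qed

text \<open>A policy maximizing the sum of its values cannot be improved by switching a single action.\<close>

lemma exists_optimal_policy:
  fixes R :: "'s::finite \<Rightarrow> 'a::finite \<Rightarrow> real"
  assumes g: "0 \<le> \<gamma>" "\<gamma> < 1"
  obtains pol where "resolvent \<gamma> (\<lambda>s. p s (pol s)) (\<lambda>s. R s (pol s))
      = bellman \<gamma> R p (\<lambda>_. UNIV) (resolvent \<gamma> (\<lambda>s. p s (pol s)) (\<lambda>s. R s (pol s)))"
proof -
  define V where "V = (\<lambda>pol. resolvent \<gamma> (\<lambda>s. p s (pol s)) (\<lambda>s. R s (pol s)))"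
  have V: "V pol s = R s (pol s) + \<gamma> * pmf_mean (p s (pol s)) (V pol)" for pol s
    unfolding V_def by (rule resolvent_eq[OF g])
  define F where "F = (\<lambda>pol. \<Sum>s\<in>UNIV. V pol s)"
  have "Max (range F) \<in> range F" by (rule Max_in) auto
  then obtain pol where pol: "Max (range F) = F pol" unfolding image_iff by blast
  have max: "F pol' \<le> F pol" for pol' unfolding pol[symmetric] by simp
  have opt: "R s a + \<gamma> * pmf_mean (p s a) (V pol) \<le> V pol s" for s a
  proof (rule ccontr)
    assume less: "\<not> ?thesis"
    define pol' where "pol' = pol(s := a)"
    \<comment> \<open>\<open>V pol\<close> is a subsolution for the switched policy, so no state
      loses; the strict gain at \<open>s\<close> then raises the sum.\<close>
    have ge: "V pol t \<le> V pol' t" for t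
      unfolding fun_cong[OF V_def, of pol']
    proof (rule resolvent_ge[OF g])
      fix t
      show "V pol t \<le> R t (pol' t) + \<gamma> * pmf_mean (p t (pol' t)) (V pol)" for t
        using less V[of pol t] by (cases "t = s") (auto simp: pol'_def)
    qed
    have "V pol s < R s a + \<gamma> * pmf_mean (p s a) (V pol)" using less by simp
    also have "\<dots> \<le> R s a + \<gamma> * pmf_mean (p s a) (V pol')"
      using ge g by (intro add_left_mono mult_left_mono pmf_mean_mono) auto
    also have "\<dots> = V pol' s" using V[of pol' s] by (simp add: pol'_def)
    finally have "F pol < F pol'" unfolding F_def
      by (intro sum_strict_mono_ex1) (use ge in auto)
    with max[of pol'] show False by simp
  qed
  have "V pol s = bellman \<gamma> R p (\<lambda>_. UNIV) (V pol) s" for s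
  proof (rule antisym)
    show "V pol s \<le> bellman \<gamma> R p (\<lambda>_. UNIV) (V pol) s"
      by (subst V) (rule bellman_ge, simp)
    show "bellman \<gamma> R p (\<lambda>_. UNIV) (V pol) s \<le> V pol s"
      by (rule bellman_le) (use opt in auto)
  qed
  then show ?thesis using that[of pol] by (auto simp: V_def)
qed

lemma policy_value_le_bellman_fixed_point:
  assumes g: "0 \<le> \<gamma>" "\<gamma> < 1" and v: "v = bellman \<gamma> R p A v" and pol: "\<And>s. pol s \<in> A s"
  shows "resolvent \<gamma> (\<lambda>s. p s (pol s)) (\<lambda>s. R s (pol s)) s \<le> v s"
proof (rule resolvent_le[OF g])
  show "R s (pol s) + \<gamma> * pmf_mean (p s (pol s)) v \<le> v s" for s
    using bellman_ge[where A=A and s=s, OF pol, of R \<gamma> p v] by (simp flip: v)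
qed

text \<open>Uniqueness of the fixed point resolves the definite description in
  \<open>emp_opt_value\<close>.\<close>

lemma emp_opt_value_eq:
  fixes R :: "'s::finite \<Rightarrow> 'a::finite \<Rightarrow> real"
  assumes g: "0 \<le> \<gamma>" "\<gamma> < 1" and ph: "\<And>s a s'. ph s a s' = pmf (p s a) s'"
    and v: "v = bellman \<gamma> R p (\<lambda>_. UNIV) v"
  shows "emp_opt_value \<gamma> R ph = v"
proof -
  have eq: "Max (range (\<lambda>a. R s a + \<gamma> * (\<Sum>s'\<in>UNIV. ph s a s' * w s')))
      = bellman \<gamma> R p (\<lambda>_. UNIV) w s" for w s
    by (simp add: bellman_def ph pmf_mean_def)
  show ?thesis unfolding emp_opt_value_def eq
  proof (rule the_equality)
    show "\<forall>s. v s = bellman \<gamma> R p (\<lambda>_. UNIV) v s" using v by (metis)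
    fix w assume "\<forall>s. w s = bellman \<gamma> R p (\<lambda>_. UNIV) w s"
    then have "w = bellman \<gamma> R p (\<lambda>_. UNIV) w" by blast
    then show "w = v" by (intro bellman_fixed_point_unique[where A="\<lambda>_. UNIV", OF g _ _ v]) simp
  qed
qed

text \<open>Pinning the value at \<open>s0\<close> to a constant removes the dependence on the transition
  probabilities at \<open>s0\<close>; finitely many iterations replace the fixed point of the pinned operator.\<close>

fun pinned_iterate :: "real \<Rightarrow> ('s::finite \<Rightarrow> 'a::finite \<Rightarrow> real) \<Rightarrow> ('s \<Rightarrow> 'a \<Rightarrow> 's pmf)
    \<Rightarrow> ('s \<Rightarrow> 'a set) \<Rightarrow> 's \<Rightarrow> real \<Rightarrow> nat \<Rightarrow> 's \<Rightarrow> real" where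
  "pinned_iterate \<gamma> R p A s0 c 0 = (\<lambda>_. 0)"
| "pinned_iterate \<gamma> R p A s0 c (Suc k) =
     (\<lambda>s. if s = s0 then c else bellman \<gamma> R p A (pinned_iterate \<gamma> R p A s0 c k) s)"

text \<open>At \<open>s0\<close> the recursion returns \<open>c\<close> without consulting
  \<open>p\<close>. This is the independence that later allows conditioning on all samples but those
  of one pair.\<close>

lemma pinned_iterate_cong:
  assumes "\<And>s a. s \<noteq> s0 \<Longrightarrow> p s a = p' s a"
  shows "pinned_iterate \<gamma> R p A s0 c k = pinned_iterate \<gamma> R p' A s0 c k"
  by (induction k) (auto simp: bellman_def assms)

text \<open>The fixed point \<open>v\<close> obeys the recursion pinned at \<open>v s0\<close>. Away
  from \<open>s0\<close> the error contracts by \<open>\<gamma>\<close>, at \<open>s0\<close> it is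
  at most \<open>e\<close>, and starting from zero costs \<open>\<gamma> ^ k * B\<close>.\<close>

lemma pinned_iterate_close:
  assumes g: "0 \<le> \<gamma>" "\<gamma> < 1" and A: "\<And>s. A s \<noteq> {}" and v: "v = bellman \<gamma> R p A v"
    and B: "\<And>s. \<bar>v s\<bar> \<le> B" and c: "\<bar>c - v s0\<bar> \<le> e" and k: "\<gamma> ^ k * B \<le> e"
  shows "\<bar>pinned_iterate \<gamma> R p A s0 c k s - v s\<bar> \<le> e"
proof -
  have e: "0 \<le> e" using c by linarith
  have "\<bar>pinned_iterate \<gamma> R p A s0 c j s - v s\<bar> \<le> max e (\<gamma> ^ j * B)" for j s
  proof (induction j arbitrary: s)
    case 0
    then show ?case using B[of s] by simp
  next
    case (Suc j)
    show ?case
    proof (cases "s = s0")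
      case True
      then show ?thesis using c by simp
    next
      case False
      have "\<bar>bellman \<gamma> R p A (pinned_iterate \<gamma> R p A s0 c j) s - v s\<bar> \<le> \<gamma> * max e (\<gamma> ^ j * B)"
        using bellman_contraction[where A=A and s=s and v="pinned_iterate \<gamma> R p A s0 c j" and w=v, OF g(1) A Suc.IH, of R p]
        by (simp flip: v)
      also have "\<dots> = max (\<gamma> * e) (\<gamma> ^ Suc j * B)" using g by (simp add: max_mult_distrib_left mult.assoc)
      also have "\<dots> \<le> max e (\<gamma> ^ Suc j * B)" using g e by (intro max.mono) (auto simp: mult_left_le_one_le)
      finally show ?thesis using False by simp
    qed
  qed
  from this[of k s] k show ?thesis by simp
qed

text \<open>An induction over finitely many maxima and sums; this is what stopping after
  \<open>k\<close> steps buys.\<close>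

lemma measurable_pinned_iterate:
  assumes "\<And>s a. (\<lambda>z. R z s a) \<in> borel_measurable M"
  shows "(\<lambda>z. pinned_iterate \<gamma> (R z) p A s0 c k s) \<in> borel_measurable M"
proof (induction k arbitrary: s)
  case (Suc k)
  note [measurable] = assms Suc.IH
  show ?case
    by (cases "s = s0") (auto simp: bellman_def pmf_mean_def)
qed simp

section \<open>The suboptimality gap on the concentration event\<close>

definition mean_close :: "real \<Rightarrow> 's::finite pmf \<Rightarrow> 's pmf \<Rightarrow> ('s \<Rightarrow> real) \<Rightarrow> bool" where
  "mean_close l p q f \<longleftrightarrow> \<bar>pmf_mean q f - pmf_mean p f\<bar> \<le> 2 * sqrt l * pmf_sd p f + l * osc f"

text \<open>Transfers concentration from a net function \<open>w\<close> to the value function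
  \<open>v\<close>, which depends on the samples: the two means lose \<open>e\<close> each, the
  deviation \<open>e\<close> and the oscillation \<open>2 * e\<close>.\<close>

lemma mean_close_perturb:
  assumes close: "mean_close l p q w" and w: "\<And>s. \<bar>w s - v s\<bar> \<le> e" and l: "0 \<le> l"
  shows "\<bar>pmf_mean q v - pmf_mean p v\<bar> \<le> 2 * sqrt l * (pmf_sd p v + e) + l * (osc v + 2 * e) + 2 * e"
proof -
  have "\<bar>pmf_mean q w - pmf_mean q v\<bar> \<le> e" "\<bar>pmf_mean p w - pmf_mean p v\<bar> \<le> e"
    by (intro pmf_mean_abs_diff_le w)+
  moreover have "\<bar>pmf_mean q w - pmf_mean p w\<bar> \<le> 2 * sqrt l * pmf_sd p w + l * osc w"
    using close by (simp add: mean_close_def)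
  moreover have "2 * sqrt l * pmf_sd p w \<le> 2 * sqrt l * (pmf_sd p v + e)"
  proof -
    have "pmf_sd p w \<le> pmf_sd p v + pmf_sd p (\<lambda>s. w s - v s)"
      using pmf_sd_add_le[of p v "\<lambda>s. w s - v s"] by simp
    then show ?thesis using pmf_sd_le[of "\<lambda>s. w s - v s" e p] w l by (intro mult_left_mono) auto
  qed
  moreover have "l * osc w \<le> l * (osc v + 2 * e)"
    using osc_perturb_le[of w v e] w l by (intro mult_left_mono) auto
  ultimately show ?thesis by linarith
qed

text \<open>The net point is selected after sampling, separately for each state; this is legitimate
  because \<open>net\<close> covers all of them.\<close>

lemma net_policy_error:
  fixes P p :: "'s::finite \<Rightarrow> 'a::finite \<Rightarrow> 's pmf"
  assumes gamma: "1/2 \<le> \<gamma>" "\<gamma> < 1"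
    and erg: "uniformly_ergodic P" and tmin: "t_minorize P \<le> 1 / (1 - \<gamma>)"
    and R: "\<And>s a. 0 \<le> R s a" "\<And>s a. R s a \<le> 3/2"
    and A: "\<And>s. pol s \<in> A s"
    and v: "v = resolvent \<gamma> (\<lambda>s. p s (pol s)) (\<lambda>s. R s (pol s))" "v = bellman \<gamma> R p A v"
    and l: "0 < l" "128 * l \<le> 1 - \<gamma>"
    and e: "0 < e" and N: "(3/2) / (1 - \<gamma>) < (real N + 1) * e"
    and k: "\<gamma> ^ k * ((3/2) / (1 - \<gamma>)) \<le> e"
    and net: "\<And>s a j. j \<le> N \<Longrightarrow> mean_close l (P s a) (p s a) (pinned_iterate \<gamma> R p A s (real j * e) k)"
  shows "\<bar>v s - resolvent \<gamma> (\<lambda>s. P s (pol s)) (\<lambda>s. R s (pol s)) s\<bar>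
      \<le> (11 * sqrt (l * ((3/2) * t_minorize P)) + 7 * e) / (1 - \<gamma>)"
proof (rule policy_error[where K="\<lambda>s. P s (pol s)" and Kh="\<lambda>s. p s (pol s)"
      and \<rho>="\<lambda>s. R s (pol s)", OF gamma])
  have g: "0 \<le> \<gamma>" "\<gamma> < 1" using gamma by auto
  let ?u = "resolvent \<gamma> (\<lambda>s. P s (pol s)) (\<lambda>s. R s (pol s))"
  show "?u s = R s (pol s) + \<gamma> * pmf_mean (P s (pol s)) ?u" for s by (rule resolvent_eq[OF g])
  show "v s = R s (pol s) + \<gamma> * pmf_mean (p s (pol s)) v" for s
    unfolding v(1) by (rule resolvent_eq[OF g])
  show "osc ?u \<le> (3/2) * t_minorize P"
  proof (rule osc_resolvent_le[OF erg g])
    show "osc (\<lambda>s. R s (pol s)) \<le> 3/2"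
    proof (rule osc_le)
      fix s s'
      show "R s (pol s) - R s' (pol s') \<le> 3/2" using R(1)[of s' "pol s'"] R(2)[of s "pol s"] by linarith
    qed
  qed simp
  show "0 < (3/2) * t_minorize P" using t_minorize_ge_1[OF erg] by simp
  show "(3/2) * t_minorize P \<le> (3/2) / (1 - \<gamma>)"
    using mult_left_mono[OF tmin, of "3/2"] by simp
  have v_range: "0 \<le> v s" "v s \<le> (3/2) / (1 - \<gamma>)" for s
    unfolding v(1) by (rule resolvent_nonneg[OF g R(1)], rule resolvent_le_const[OF g R(2)])
  fix s
  \<comment> \<open>Rounding down moves the value at \<open>s\<close> by less than \<open>e\<close>,
    and \<open>N\<close> keeps the index inside the net.\<close>
  define j where "j = nat \<lfloor>v s / e\<rfloor>"
  have "v s / e < real N + 1" using v_range(2)[of s] N e by (simp add: pos_divide_less_eq)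
  then have "j \<le> N" using v_range(1)[of s] e by (simp add: j_def) linarith
  then have close: "mean_close l (P s (pol s)) (p s (pol s)) (pinned_iterate \<gamma> R p A s (real j * e) k)"
    by (rule net)
  have j: "real j \<le> v s / e" "v s / e < real j + 1"
    using v_range(1)[of s] e by (auto simp: j_def of_nat_nat)
  then have "\<bar>real j * e - v s\<bar> \<le> e" using e by (simp add: field_simps abs_le_iff)
  then have "\<bar>pinned_iterate \<gamma> R p A s (real j * e) k t - v t\<bar> \<le> e" for t
    using v_range k A by (intro pinned_iterate_close[OF g _ v(2)]) auto
  from mean_close_perturb[OF close this] l(1)
  show "\<bar>pmf_mean (p s (pol s)) v - pmf_mean (P s (pol s)) v\<bar>
      \<le> 2 * sqrt l * (pmf_sd (P s (pol s)) v + e) + l * (osc v + 2 * e) + 2 * e" by simp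
qed (use R l e in auto)

lemma resolvent_mono:
  assumes "0 \<le> \<gamma>" "\<gamma> < 1" "\<And>s. f s \<le> g s"
  shows "resolvent \<gamma> K f s \<le> resolvent \<gamma> K g s"
proof (rule resolvent_le[OF assms(1,2)])
  fix s
  show "f s + \<gamma> * pmf_mean (K s) (resolvent \<gamma> K g) \<le> resolvent \<gamma> K g s"
    using resolvent_eq[OF assms(1,2), of K g s] assms(3)[of s] by linarith
qed

section \<open>Optimal values and the output of the algorithm\<close>

lemma opt_value_eq_pol_value:
  fixes P :: "'s::finite \<Rightarrow> 'a::finite \<Rightarrow> 's pmf"
  assumes g: "0 \<le> \<gamma>" "\<gamma> < 1"
    and opt: "pol_value \<gamma> P r pol = bellman \<gamma> r P (\<lambda>_. UNIV) (pol_value \<gamma> P r pol)"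
  shows "opt_value \<gamma> P r s = pol_value \<gamma> P r pol s"
  unfolding opt_value_def
proof (rule Max_eqI)
  fix y assume "y \<in> (\<lambda>pol. pol_value \<gamma> P r pol s) ` UNIV"
  then obtain pol' where "y = pol_value \<gamma> P r pol' s" by blast
  then show "y \<le> pol_value \<gamma> P r pol s"
    using policy_value_le_bellman_fixed_point[OF g opt, of pol' s]
    by (simp add: pol_value_eq_resolvent)
qed auto

lemma opt_value_ge: "pol_value \<gamma> P r pol s \<le> opt_value \<gamma> P r s"
  unfolding opt_value_def by (rule Max_ge) auto

lemma value_gap_le_horizon:
  fixes P :: "'s::finite \<Rightarrow> 'a::finite \<Rightarrow> 's pmf"
  assumes g: "0 \<le> \<gamma>" "\<gamma> < 1" and r: "\<And>s a. 0 \<le> r s a \<and> r s a \<le> 1"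
  shows "opt_value \<gamma> P r s - pol_value \<gamma> P r pol s \<le> 1 / (1 - \<gamma>)"
proof -
  have "opt_value \<gamma> P r s \<le> 1 / (1 - \<gamma>)"
    unfolding opt_value_def
  proof (rule Max.boundedI)
    fix y assume "y \<in> (\<lambda>pol. pol_value \<gamma> P r pol s) ` UNIV"
    then obtain pol' where "y = pol_value \<gamma> P r pol' s" by blast
    also have "\<dots> \<le> 1 / (1 - \<gamma>)"
      unfolding pol_value_eq_resolvent by (rule resolvent_le_const[OF g]) (use r in auto)
    finally show "y \<le> 1 / (1 - \<gamma>)" .
  qed auto
  moreover have "0 \<le> pol_value \<gamma> P r pol s"
    unfolding pol_value_eq_resolvent by (rule resolvent_nonneg[OF g]) (use r in auto)
  ultimately show ?thesis by simp
qed

lemma pmf_sample_pmf: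
  assumes "0 < n"
  shows "pmf (sample_pmf n (X (s, a))) s' = emp_dist X n s a s'"
  using assms
  by (simp add: sample_pmf_def pmf_map measure_pmf_of_set lessThan_empty_iff emp_dist_def
      Collect_conj_eq vimage_def flip: lessThan_def)

text \<open>A policy greedy for the empirical fixed point \<open>w\<close> satisfies its own
  evaluation equation at \<open>w\<close>, hence has value \<open>w\<close>, however ties are
  broken.\<close>

lemma pmbp_output_fixed_point:
  fixes r :: "'s::finite \<Rightarrow> 'a::finite \<Rightarrow> real"
  assumes g: "0 \<le> \<gamma>" "\<gamma> < 1" and n: "0 < n"
    and out: "pmbp_output \<gamma> r n (Z, X) pol"
  defines "p \<equiv> \<lambda>s a. sample_pmf n (X (s, a))" and "R \<equiv> pert_reward r Z"
  defines "v \<equiv> resolvent \<gamma> (\<lambda>s. p s (pol s)) (\<lambda>s. R s (pol s))"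
  shows "v = bellman \<gamma> R p (\<lambda>_. UNIV) v"
proof -
  obtain pol0 where *: "resolvent \<gamma> (\<lambda>s. p s (pol0 s)) (\<lambda>s. R s (pol0 s))
      = bellman \<gamma> R p (\<lambda>_. UNIV) (resolvent \<gamma> (\<lambda>s. p s (pol0 s)) (\<lambda>s. R s (pol0 s)))"
    by (rule exists_optimal_policy[OF g, of p R])
  define w where "w = resolvent \<gamma> (\<lambda>s. p s (pol0 s)) (\<lambda>s. R s (pol0 s))"
  have w: "w = bellman \<gamma> R p (\<lambda>_. UNIV) w" using * by (simp only: w_def)
  have ph: "emp_dist X n s a s' = pmf (p s a) s'" for s a s'
    by (simp add: p_def pmf_sample_pmf[OF n])
  have "emp_opt_value \<gamma> R (emp_dist X n) = w"
    by (rule emp_opt_value_eq[OF g ph w])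
  then have greedy: "R s b + \<gamma> * pmf_mean (p s b) w \<le> R s (pol s) + \<gamma> * pmf_mean (p s (pol s)) w" for s b
    using out by (simp add: pmbp_output_def Let_def R_def[symmetric] ph pmf_mean_def)
  have "w s = R s (pol s) + \<gamma> * pmf_mean (p s (pol s)) w" for s
  proof (rule antisym)
    show "w s \<le> R s (pol s) + \<gamma> * pmf_mean (p s (pol s)) w"
      by (subst w) (rule bellman_le, simp, rule greedy)
    show "R s (pol s) + \<gamma> * pmf_mean (p s (pol s)) w \<le> w s"
      by (subst (2) w) (rule bellman_ge, simp)
  qed
  then have "w = v" unfolding v_def by (rule resolvent_unique[OF g])
  with w show ?thesis by simp
qed

text \<open>Comparing the optimal policy and the output through their values under the perturbed
  reward costs a single \<open>\<zeta> / (1 - \<gamma>)\<close>; the other half of \<open>2 * \<zeta> / (1 - \<gamma>)\<close> pays for the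
  resolution \<open>e\<close> of the net.\<close>

lemma pmbp_gap:
  fixes r :: "'s::finite \<Rightarrow> 'a::finite \<Rightarrow> real" and P :: "'s \<Rightarrow> 'a \<Rightarrow> 's pmf"
  assumes gamma: "1/2 \<le> \<gamma>" "\<gamma> < 1"
    and r: "\<And>s a. 0 \<le> r s a \<and> r s a \<le> 1"
    and erg: "uniformly_ergodic P" and tmin: "t_minorize P \<le> 1 / (1 - \<gamma>)"
    and Z: "\<And>sa. 0 \<le> Z sa \<and> Z sa \<le> \<zeta>" "\<zeta> \<le> 1/2"
    and n: "0 < n"
    and l: "0 < l" "128 * l \<le> 1 - \<gamma>"
    and e: "0 < e" and N: "(3/2) / (1 - \<gamma>) < (real N + 1) * e"
    and k: "\<gamma> ^ k * ((3/2) / (1 - \<gamma>)) \<le> e"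
    and opt: "pol_value \<gamma> P r pol' = bellman \<gamma> r P (\<lambda>_. UNIV) (pol_value \<gamma> P r pol')"
    and net: "\<And>A s a j. A \<in> {\<lambda>_. UNIV, \<lambda>s. {pol' s}} \<Longrightarrow> j \<le> N \<Longrightarrow>
       mean_close l (P s a) (sample_pmf n (X (s, a)))
         (pinned_iterate \<gamma> (pert_reward r Z) (\<lambda>s a. sample_pmf n (X (s, a))) A s (real j * e) k)"
    and out: "pmbp_output \<gamma> r n (Z, X) pol"
  shows "opt_value \<gamma> P r s - pol_value \<gamma> P r pol s
      \<le> \<zeta> / (1 - \<gamma>) + 2 * ((11 * sqrt (l * ((3/2) * t_minorize P)) + 7 * e) / (1 - \<gamma>))"
proof -
  have g: "0 \<le> \<gamma>" "\<gamma> < 1" using gamma by auto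
  define R where "R = pert_reward r Z"
  define p where "p = (\<lambda>s a. sample_pmf n (X (s, a)))"
  let ?E = "(11 * sqrt (l * ((3/2) * t_minorize P)) + 7 * e) / (1 - \<gamma>)"
  have R: "0 \<le> R s a" "R s a \<le> 3/2" "r s a \<le> R s a" "R s a \<le> r s a + \<zeta>" for s a
    using r[of s a] Z(1)[of "(s, a)"] Z(2) by (auto simp: R_def pert_reward_def)
  define V where "V = (\<lambda>q pol. resolvent \<gamma> (\<lambda>s. q s (pol s)) (\<lambda>s. R s (pol s)))"
  have fix_pol: "V p pol = bellman \<gamma> R p (\<lambda>_. UNIV) (V p pol)"
    unfolding V_def p_def R_def by (rule pmbp_output_fixed_point[OF g n out])
  \<comment> \<open>With singleton action sets the Bellman equation is the evaluation equation of
    \<open>pol'\<close>, so \<open>pol'\<close> need not be optimal empirically.\<close>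
  have fix_pol': "V p pol' = bellman \<gamma> R p (\<lambda>s. {pol' s}) (V p pol')"
    unfolding bellman_def V_def image_insert image_empty Max_singleton
    by (rule ext) (rule resolvent_eq[OF g])
  have E1: "\<bar>V p pol s - V P pol s\<bar> \<le> ?E"
    unfolding V_def
    by (rule net_policy_error[OF gamma erg tmin R(1,2) _ refl _ l e N k, where A="\<lambda>_. UNIV"])
      (use net fix_pol in \<open>auto simp: V_def p_def R_def\<close>)
  have E2: "\<bar>V p pol' s - V P pol' s\<bar> \<le> ?E"
    unfolding V_def
    by (rule net_policy_error[OF gamma erg tmin R(1,2) _ refl _ l e N k, where A="\<lambda>s. {pol' s}"])
      (use net fix_pol' in \<open>auto simp: V_def p_def R_def\<close>)
  have "opt_value \<gamma> P r s = pol_value \<gamma> P r pol' s" by (rule opt_value_eq_pol_value[OF g opt])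
  also have "\<dots> \<le> V P pol' s"
    unfolding V_def pol_value_eq_resolvent by (rule resolvent_mono[OF g R(3)])
  also have "\<dots> \<le> V p pol' s + ?E" using E2 by (simp add: abs_le_iff)
  also have "V p pol' s \<le> V p pol s"
    using policy_value_le_bellman_fixed_point[OF g fix_pol, of pol'] by (simp add: V_def)
  also have "V p pol s \<le> V P pol s + ?E" using E1 by (simp add: abs_le_iff)
  \<comment> \<open>Since \<open>R \<le> r + \<zeta>\<close>, the unperturbed value plus
    \<open>\<zeta> / (1 - \<gamma>)\<close> is a supersolution for the perturbed reward.\<close>
  also have "V P pol s \<le> pol_value \<gamma> P r pol s + \<zeta> / (1 - \<gamma>)"
    unfolding V_def
  proof (rule resolvent_le[OF g])
    fix s
    have "\<zeta> + \<gamma> * (\<zeta> / (1 - \<gamma>)) = \<zeta> / (1 - \<gamma>)" using g by (simp add: field_simps)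
    moreover have "pol_value \<gamma> P r pol s = r s (pol s) + \<gamma> * pmf_mean (P s (pol s)) (pol_value \<gamma> P r pol)"
      unfolding pol_value_eq_resolvent by (rule resolvent_eq[OF g])
    ultimately show "R s (pol s) + \<gamma> * pmf_mean (P s (pol s)) (\<lambda>s. pol_value \<gamma> P r pol s + \<zeta> / (1 - \<gamma>))
        \<le> pol_value \<gamma> P r pol s + \<zeta> / (1 - \<gamma>)"
      using R(4)[of s "pol s"] by (simp add: pmf_mean_add distrib_left)
  qed
  finally show ?thesis by simp
qed

section \<open>Probability of the concentration event\<close>

abbreviation samples :: "('s::finite \<Rightarrow> 'a::finite \<Rightarrow> 's pmf) \<Rightarrow> nat
    \<Rightarrow> ('s \<times> 'a \<Rightarrow> nat \<Rightarrow> 's) measure" where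
  "samples P n \<equiv> PiM UNIV (\<lambda>sa. PiM {..<n} (\<lambda>_. measure_pmf (P (fst sa) (snd sa))))"

lemma prob_space_PiM_pmf: "prob_space (PiM I (\<lambda>_. measure_pmf p))"
  by (intro prob_space_PiM prob_space_measure_pmf)

lemma sets_samples:
  assumes "B \<subseteq> space (samples P n)"
  shows "B \<in> sets (samples P n)"
  using assms
  by (intro sets_PiM_finite_discrete) (auto simp: space_PiM_pmf intro!: finite_PiE)

text \<open>Fubini with the samples of \<open>(s, a)\<close> integrated innermost: the pinned
  iterate is then a fixed function, and Bernstein's bound holds uniformly in the other
  samples.\<close>

lemma emeasure_pinned_iterate_not_close:
  fixes P :: "'s::finite \<Rightarrow> 'a::finite \<Rightarrow> 's pmf"
  assumes n: "0 < n" and L: "0 < L"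
  defines "M \<equiv> samples P n"
  shows "emeasure M {X \<in> space M. \<not> mean_close (L / n) (P s a) (sample_pmf n (X (s, a)))
           (pinned_iterate \<gamma> R (\<lambda>s a. sample_pmf n (X (s, a))) A s c k)}
         \<le> ennreal (2 * exp (- L))"
proof -
  define N where "N = (\<lambda>sa :: 's \<times> 'a. PiM {..<n} (\<lambda>_. measure_pmf (P (fst sa) (snd sa))))"
  have N: "prob_space (N sa)" for sa unfolding N_def by (rule prob_space_PiM_pmf)
  interpret product_sigma_finite N
    by (simp add: product_sigma_finite_def N prob_space_imp_sigma_finite)
  define I where "I = UNIV - {(s, a)}"
  have M: "M = PiM (insert (s, a) I) N" by (simp add: M_def N_def I_def insert_absorb)
  define w where "w = (\<lambda>X :: 's \<times> 'a \<Rightarrow> nat \<Rightarrow> 's. pinned_iterate \<gamma> R (\<lambda>s a. sample_pmf n (X (s, a))) A s c k)"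
  have w_upd: "w (X((s, a) := y)) = w X" for X y
    unfolding w_def by (rule pinned_iterate_cong) auto
  define B where "B = {X \<in> space M. \<not> mean_close (L / n) (P s a) (sample_pmf n (X (s, a))) (w X)}"
  have B: "B \<in> sets M" unfolding M_def by (rule sets_samples) (auto simp: B_def M_def)
  interpret PI: prob_space "PiM I N" by (rule prob_space_PiM) (rule N)
  have "emeasure M B = (\<integral>\<^sup>+X. indicator B X \<partial>M)" using B by simp
  also have "\<dots> = (\<integral>\<^sup>+X. (\<integral>\<^sup>+y. indicator B (X((s, a) := y)) \<partial>N (s, a)) \<partial>PiM I N)"
    unfolding M by (rule product_nn_integral_insert) (use B M in \<open>auto simp: I_def\<close>)
  also have "\<dots> \<le> (\<integral>\<^sup>+X. ennreal (2 * exp (- L)) \<partial>PiM I N)"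
  proof (rule nn_integral_mono)
    fix X
    let ?C = "{y \<in> space (N (s, a)). \<not> mean_close (L / n) (P s a) (sample_pmf n y) (w X)}"
    have C: "?C \<in> sets (N (s, a))" by (auto simp: N_def space_PiM_pmf)
    have "(\<integral>\<^sup>+y. indicator B (X((s, a) := y)) \<partial>N (s, a)) \<le> (\<integral>\<^sup>+y. indicator ?C y \<partial>N (s, a))"
      by (intro nn_integral_mono) (auto simp: B_def w_upd indicator_def)
    also have "\<dots> = emeasure (N (s, a)) ?C" using C by simp
    also have "\<dots> \<le> ennreal (2 * exp (- L))"
      unfolding N_def mean_close_def fst_conv snd_conv by (rule bernstein_sample_pmf[OF n L])
    finally show "(\<integral>\<^sup>+y. indicator B (X((s, a) := y)) \<partial>N (s, a)) \<le> ennreal (2 * exp (- L))" .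
  qed
  also have "\<dots> = ennreal (2 * exp (- L))" by (simp add: PI.emeasure_space_1)
  finally show ?thesis by (simp only: B_def w_def)
qed

text \<open>The members of \<open>\<A>\<close> must be fixed before sampling, or the iterates could
  depend on the samples at \<open>s\<close>.\<close>

definition net_close :: "real \<Rightarrow> ('s::finite \<Rightarrow> 'a::finite \<Rightarrow> 's pmf) \<Rightarrow> nat \<Rightarrow> ('s \<Rightarrow> 'a set) set
    \<Rightarrow> real \<Rightarrow> nat \<Rightarrow> real \<Rightarrow> nat \<Rightarrow> ('s \<Rightarrow> 'a \<Rightarrow> real) \<Rightarrow> ('s \<times> 'a \<Rightarrow> nat \<Rightarrow> 's) \<Rightarrow> bool" where
  "net_close \<gamma> P n \<A> l N e k R X \<longleftrightarrow> (\<forall>A\<in>\<A>. \<forall>s a. \<forall>j\<in>{..N}.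
     mean_close l (P s a) (sample_pmf n (X (s, a)))
       (pinned_iterate \<gamma> R (\<lambda>s a. sample_pmf n (X (s, a))) A s (real j * e) k))"

text \<open>Union bound for a fixed reward \<open>R\<close>; the noise is integrated out
  afterwards.\<close>

lemma emeasure_not_net_close:
  fixes P :: "'s::finite \<Rightarrow> 'a::finite \<Rightarrow> 's pmf"
  assumes n: "0 < n" and L: "0 < L"
  defines "M \<equiv> samples P n"
  shows "emeasure M {X \<in> space M. \<not> net_close \<gamma> P n \<A> (L / n) N e k R X}
    \<le> ennreal (real (card \<A> * (CARD('s) * CARD('a)) * Suc N) * (2 * exp (- L)))"
proof -
  define J where "J = \<A> \<times> (UNIV :: ('s \<times> 'a) set) \<times> {..N}"
  define B where "B = (\<lambda>(A, (s, a), j). {X \<in> space M. \<not> mean_close (L / n) (P s a) (sample_pmf n (X (s, a)))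
           (pinned_iterate \<gamma> R (\<lambda>s a. sample_pmf n (X (s, a))) A s (real j * e) k)})"
  have B: "B i \<in> sets M" for i unfolding M_def
    by (rule sets_samples) (auto simp: B_def M_def split: prod.splits)
  have J: "finite J" "card J = card \<A> * (CARD('s) * CARD('a)) * Suc N"
    by (simp_all add: J_def card_cartesian_product card_prod algebra_simps)
  have "{X \<in> space M. \<not> net_close \<gamma> P n \<A> (L / n) N e k R X} = (\<Union>i\<in>J. B i)"
    by (auto simp: net_close_def J_def B_def split: prod.splits) blast
  then have "emeasure M {X \<in> space M. \<not> net_close \<gamma> P n \<A> (L / n) N e k R X} \<le> (\<Sum>i\<in>J. emeasure M (B i))"
    using B J by (auto intro!: emeasure_subadditive_finite)
  also have "\<dots> \<le> (\<Sum>i\<in>J. ennreal (2 * exp (- L)))"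
    using emeasure_pinned_iterate_not_close[OF n L, of P _ _ \<gamma> R]
    by (intro sum_mono) (auto simp: B_def M_def split: prod.splits)
  also have "\<dots> = ennreal (real (card J) * (2 * exp (- L)))"
    by (simp add: ennreal_mult ennreal_of_nat_eq_real_of_nat)
  finally show ?thesis unfolding J(2) .
qed

section \<open>The reward noise and joint measurability\<close>

abbreviation noise_space :: "real \<Rightarrow> ('s::finite \<times> 'a::finite \<Rightarrow> real) measure" where
  "noise_space \<zeta> \<equiv> PiM UNIV (\<lambda>_. uniform_measure lborel {0<..<\<zeta>})"

lemma prob_space_noise:
  fixes \<zeta> :: real
  assumes "0 < \<zeta>"
  shows "prob_space (uniform_measure lborel {0<..<\<zeta>})"
  by (rule prob_space_uniform_measure) (use assms in \<open>simp_all add: emeasure_lborel_Ioo\<close>)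

lemma AE_noise_range:
  fixes \<zeta> :: real
  assumes "0 < \<zeta>"
  shows "AE Z in (noise_space \<zeta> :: ('s::finite \<times> 'a::finite \<Rightarrow> real) measure). \<forall>sa. 0 \<le> Z sa \<and> Z sa \<le> \<zeta>"
proof -
  have "AE z in uniform_measure lborel {0<..<\<zeta>}. 0 \<le> z \<and> z \<le> \<zeta>"
    by (rule AE_uniform_measureI) auto
  then have "AE Z in (noise_space \<zeta> :: ('s \<times> 'a \<Rightarrow> real) measure). 0 \<le> Z sa \<and> Z sa \<le> \<zeta>" for sa :: "'s \<times> 'a"
    by (intro AE_PiM_component prob_space_noise assms) auto
  then show ?thesis by (simp add: AE_all_countable)
qed

lemma measurable_mean_close:
  assumes [measurable]: "\<And>t. (\<lambda>z. w z t) \<in> borel_measurable M"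
  shows "{z \<in> space M. mean_close l p q (w z)} \<in> sets M"
proof -
  have mean: "(\<lambda>z. pmf_mean p (f z)) \<in> borel_measurable M"
    if [measurable]: "\<And>t. (\<lambda>z. f z t) \<in> borel_measurable M" for p f
    unfolding pmf_mean_def by measurable
  have [measurable]: "(\<lambda>z. pmf_mean p (w z)) \<in> borel_measurable M" for p
    by (rule mean) measurable
  have [measurable]: "(\<lambda>z. pmf_var p (w z)) \<in> borel_measurable M"
    unfolding pmf_var_def by (rule mean) measurable
  have [measurable]: "(\<lambda>z. pmf_sd p (w z)) \<in> borel_measurable M"
    unfolding pmf_sd_def by measurable
  have [measurable]: "(\<lambda>z. osc (w z)) \<in> borel_measurable M"
    unfolding osc_def by (intro borel_measurable_diff borel_measurable_Max borel_measurable_Min) auto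
  show ?thesis unfolding mean_close_def by measurable
qed

lemma measurable_net_close:
  fixes P :: "'s::finite \<Rightarrow> 'a::finite \<Rightarrow> 's pmf"
  assumes "finite \<A>"
  shows "{Z \<in> space (noise_space \<zeta>). net_close \<gamma> P n \<A> l N e k (pert_reward r Z) X} \<in> sets (noise_space \<zeta>)"
proof -
  have "measurable M (uniform_measure lborel {0<..<\<zeta>}) = borel_measurable M" for M :: "('s \<times> 'a \<Rightarrow> real) measure"
    by (rule measurable_cong_sets) simp_all
  then have "(\<lambda>Z. Z sa) \<in> borel_measurable (noise_space \<zeta>)" for sa :: "'s \<times> 'a"
    using measurable_component_singleton[of sa UNIV "\<lambda>_. uniform_measure lborel {0<..<\<zeta>}"] by simp
  then have "(\<lambda>Z. pert_reward r Z s a) \<in> borel_measurable (noise_space \<zeta>)" for s :: 's and a :: 'a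
    unfolding pert_reward_def by (intro borel_measurable_add borel_measurable_const)
  then have close: "{Z \<in> space (noise_space \<zeta>). mean_close l p q (pinned_iterate \<gamma> (pert_reward r Z) p' A s c k)}
      \<in> sets (noise_space \<zeta>)" for p q and p' :: "'s \<Rightarrow> 'a \<Rightarrow> 's pmf" and A s c
    by (intro measurable_mean_close measurable_pinned_iterate)
  have "{Z \<in> space (noise_space \<zeta>). \<forall>A\<in>\<A>. \<forall>s\<in>UNIV. \<forall>a\<in>UNIV. \<forall>j\<in>{..N}.
     mean_close l (P s a) (sample_pmf n (X (s, a)))
       (pinned_iterate \<gamma> (pert_reward r Z) (\<lambda>s a. sample_pmf n (X (s, a))) A s (real j * e) k)}
     \<in> sets (noise_space \<zeta>)"
    by (intro sets.sets_Collect_finite_All close assms finite finite_atMost)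
  then show ?thesis by (simp add: net_close_def)
qed

lemma prob_space_samples: "prob_space (samples P n)"
  by (intro prob_space_PiM prob_space_measure_pmf)

lemma prob_space_noise_space: "0 < \<zeta> \<Longrightarrow> prob_space (noise_space \<zeta>)"
  by (intro prob_space_PiM prob_space_noise)

lemma prob_space_pmbp_space: "0 < \<zeta> \<Longrightarrow> prob_space (pmbp_space P \<zeta> n)"
  unfolding pmbp_space_def by (intro prob_space_pair prob_space_noise_space prob_space_samples)

text \<open>Independence of noise and samples makes the reward a constant once \<open>Z\<close> is
  fixed, so the union bound integrates over the noise unchanged.\<close>

lemma pmbp_net_event:
  fixes P :: "'s::finite \<Rightarrow> 'a::finite \<Rightarrow> 's pmf" and \<gamma> e :: real and k :: nat
    and r :: "'s \<Rightarrow> 'a \<Rightarrow> real"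
  assumes zeta: "0 < \<zeta>" and n: "0 < n" and L: "0 < L" and \<A>: "finite \<A>"
    and \<delta>: "real (card \<A> * (CARD('s) * CARD('a)) * Suc N) * (2 * exp (- L)) \<le> \<delta>"
  defines "E \<equiv> {\<omega> \<in> space (pmbp_space P \<zeta> n). (\<forall>sa. 0 \<le> fst \<omega> sa \<and> fst \<omega> sa \<le> \<zeta>)
      \<and> net_close \<gamma> P n \<A> (L / n) N e k (pert_reward r (fst \<omega>)) (snd \<omega>)}"
  shows "E \<in> sets (pmbp_space P \<zeta> n)" and "1 - \<delta> \<le> measure (pmbp_space P \<zeta> n) E"
proof -
  let ?Z = "noise_space \<zeta> :: ('s \<times> 'a \<Rightarrow> real) measure" and ?X = "samples P n"
  let ?M = "pmbp_space P \<zeta> n"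
  interpret Z: prob_space ?Z by (rule prob_space_noise_space[OF zeta])
  interpret X: prob_space ?X by (rule prob_space_samples)
  interpret M: prob_space ?M by (rule prob_space_pmbp_space[OF zeta])
  have space: "space ?M = space ?Z \<times> space ?X" by (simp add: pmbp_space_def space_pair_measure)
  let ?S = "\<lambda>X. {Z \<in> space ?Z. \<forall>sa. 0 \<le> Z sa \<and> Z sa \<le> \<zeta>}
      \<inter> {Z \<in> space ?Z. net_close \<gamma> P n \<A> (L / n) N e k (pert_reward r Z) X}"
  have fin: "finite (space ?X)" by (auto simp: space_PiM intro!: finite_PiE)
  have box: "{Z \<in> space ?Z. \<forall>sa. 0 \<le> Z sa \<and> Z sa \<le> \<zeta>} \<in> sets ?Z"
  proof -
    have "{Z \<in> space ?Z. \<forall>sa. 0 \<le> Z sa \<and> Z sa \<le> \<zeta>} = PiE UNIV (\<lambda>_. {0..\<zeta>})"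
      by (auto simp: space_PiM)
    also have "\<dots> \<in> sets ?Z" by (intro sets_PiM_I_finite) auto
    finally show ?thesis .
  qed
  \<comment> \<open>There are only finitely many sample outcomes, so measurability in the noise on
    each slice gives joint measurability.\<close>
  have "E = (\<Union>X\<in>space ?X. ?S X \<times> {X})" unfolding E_def space by auto
  also have "\<dots> \<in> sets (?Z \<Otimes>\<^sub>M ?X)"
    by (intro sets.finite_UN fin pair_measureI sets.Int box measurable_net_close \<A> sets_samples) auto
  finally show E: "E \<in> sets ?M" by (simp add: pmbp_space_def)
  have "emeasure ?M (space ?M - E) = (\<integral>\<^sup>+Z. emeasure ?X (Pair Z -` (space ?M - E)) \<partial>?Z)"
    using sets.compl_sets[OF E] unfolding pmbp_space_def by (intro X.emeasure_pair_measure_alt) auto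
  also have "\<dots> \<le> (\<integral>\<^sup>+Z. ennreal \<delta> \<partial>?Z)"
  proof (rule nn_integral_mono_AE)
    show "AE Z in ?Z. emeasure ?X (Pair Z -` (space ?M - E)) \<le> ennreal \<delta>"
      using AE_noise_range[OF zeta]
    proof eventually_elim
      case (elim Z)
      have "Pair Z -` (space ?M - E)
          \<subseteq> {X \<in> space ?X. \<not> net_close \<gamma> P n \<A> (L / n) N e k (pert_reward r Z) X}"
        using elim by (auto simp: E_def space)
      then have "emeasure ?X (Pair Z -` (space ?M - E))
          \<le> emeasure ?X {X \<in> space ?X. \<not> net_close \<gamma> P n \<A> (L / n) N e k (pert_reward r Z) X}"
        by (rule emeasure_mono) (rule sets_samples, auto)
      also have "\<dots> \<le> ennreal (real (card \<A> * (CARD('s) * CARD('a)) * Suc N) * (2 * exp (- L)))"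
        by (rule emeasure_not_net_close[OF n L])
      also have "\<dots> \<le> ennreal \<delta>" by (rule ennreal_leI[OF \<delta>])
      finally show ?case .
    qed
  qed
  also have "\<dots> = ennreal \<delta>" by (simp add: Z.emeasure_space_1)
  finally have "measure ?M (space ?M - E) \<le> \<delta>"
  proof -
    assume *: "emeasure ?M (space ?M - E) \<le> ennreal \<delta>"
    have "0 \<le> \<delta>" using \<delta> by (rule order_trans[rotated]) simp
    then show ?thesis using * by (simp add: M.emeasure_eq_measure)
  qed
  then show "1 - \<delta> \<le> measure ?M E" using M.prob_compl[OF E] by simp
qed

section \<open>The sample complexity bound\<close>

text \<open>Inserting \<open>eta_star\<close> gives \<open>24 * 9 = 216\<close> and the third power
  of \<open>1 - \<gamma>\<close>. The dropped factors, \<open>|S| * |A|^2\<close>, the base-2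
  logarithm and \<open>1 / \<delta>\<close>, are each at least 1, the logarithm because
  \<open>\<gamma> \<ge> 1/2\<close>.\<close>

lemma beta_delta_eta_star:
  fixes \<gamma> \<zeta> \<delta> :: real
  assumes gamma: "1/2 \<le> \<gamma>" "\<gamma> < 1" and zeta: "0 < \<zeta>" and delta: "0 < \<delta>" "\<delta> < 1"
  obtains q where "beta_delta TYPE('s::finite) TYPE('a::finite) \<gamma> \<delta> (eta_star TYPE('s) TYPE('a) \<gamma> \<zeta> \<delta>) = 2 * ln q"
    and "216 * (real CARD('s) * real CARD('a)) / ((1 - \<gamma>) ^ 3 * (\<zeta> * \<delta>)) \<le> q"
proof
  let ?S = "real CARD('s)" and ?A = "real CARD('a)"
  let ?q = "24 * ?S * ?A * log 2 (1 / (1 - \<gamma>)) / ((1 - \<gamma>)\<^sup>2 * eta_star TYPE('s) TYPE('a) \<gamma> \<zeta> \<delta> * \<delta>)"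
  show "beta_delta TYPE('s) TYPE('a) \<gamma> \<delta> (eta_star TYPE('s) TYPE('a) \<gamma> \<zeta> \<delta>) = 2 * ln ?q"
    by (simp add: beta_delta_def)
  have S: "1 \<le> ?S" "1 \<le> ?A" by (simp_all add: Suc_leI)
  define X where "X = 216 * (?S * ?A) / ((1 - \<gamma>) ^ 3 * (\<zeta> * \<delta>))"
  have X: "0 \<le> X" using gamma zeta delta by (simp add: X_def)
  have "2 powr 1 \<le> 1 / (1 - \<gamma>)" using gamma by (simp add: field_simps)
  then have log: "1 \<le> log 2 (1 / (1 - \<gamma>))" using gamma by (subst le_log_iff) auto
  have d: "1 \<le> 1 / \<delta>" using delta by simp
  have "1 * 1 * 1 * 1 * 1 \<le> ?S * ?A * ?A * log 2 (1 / (1 - \<gamma>)) * (1 / \<delta>)"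
    using S log d by (intro mult_mono) (auto intro!: mult_nonneg_nonneg)
  then have "X * 1 \<le> X * (?S * ?A * ?A * log 2 (1 / (1 - \<gamma>)) * (1 / \<delta>))"
    using X by (intro mult_left_mono) simp_all
  also have "\<dots> = ?q"
    using gamma zeta delta S
    by (simp add: X_def eta_star_def divide_simps) (simp add: algebra_simps power2_eq_square power3_eq_cube)
  finally show "216 * (?S * ?A) / ((1 - \<gamma>) ^ 3 * (\<zeta> * \<delta>)) \<le> ?q" by (simp add: X_def)
qed

lemma pmbp_bound_small_noise:
  fixes r :: "'s::finite \<Rightarrow> 'a::finite \<Rightarrow> real"
    and P :: "'s \<Rightarrow> 'a \<Rightarrow> 's pmf"
    and \<gamma> \<delta> \<zeta> :: real
  assumes r: "\<And>s a. 0 \<le> r s a \<and> r s a \<le> 1"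
    and erg: "uniformly_ergodic P"
    and gamma: "1/2 \<le> \<gamma>" "\<gamma> < 1"
    and tmin: "t_minorize P \<le> 1 / (1 - \<gamma>)"
    and delta: "0 < \<delta>" "\<delta> < 1"
    and zeta: "0 < \<zeta>" "\<zeta> \<le> 1/2" and n: "1 \<le> n"
  defines "\<beta> \<equiv> beta_delta TYPE('s) TYPE('a) \<gamma> \<delta> (eta_star TYPE('s) TYPE('a) \<gamma> \<zeta> \<delta>)"
  assumes n_ge: "real n \<ge> 64 * \<beta> / (1 - \<gamma>)"
  shows "\<exists>E \<in> sets (pmbp_space P \<zeta> n). measure (pmbp_space P \<zeta> n) E \<ge> 1 - \<delta> \<and>
    (\<forall>\<omega>\<in>E. \<forall>pol. pmbp_output \<gamma> r n \<omega> pol \<longrightarrow>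
      (\<forall>s. opt_value \<gamma> P r s - pol_value \<gamma> P r pol s
            \<le> 2 * \<zeta> / (1 - \<gamma>) + 486 * sqrt (\<beta> * t_minorize P / ((1 - \<gamma>)^2 * real n))))"
proof -
  define H where "H = 1 / (1 - \<gamma>)"
  define T where "T = t_minorize P"
  let ?SA = "real CARD('s) * real CARD('a)"
  have g: "0 \<le> \<gamma>" "\<gamma> < 1" "0 < 1 - \<gamma>" using gamma by auto
  have H: "2 \<le> H" "0 < H" using gamma by (auto simp: H_def field_simps)
  have SA: "1 \<le> ?SA" using mult_mono[of 1 "real CARD('s)" 1 "real CARD('a)"] by (simp add: Suc_leI)
  obtain q where q: "\<beta> = 2 * ln q" "216 * ?SA / ((1 - \<gamma>) ^ 3 * (\<zeta> * \<delta>)) \<le> q"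
    unfolding \<beta>_def by (rule beta_delta_eta_star[OF gamma zeta(1) delta])
  have q_ge: "216 * ?SA * H ^ 3 / (\<zeta> * \<delta>) \<le> q" using q(2) by (simp add: H_def power_one_over field_simps)
  have "1 < 216 * ?SA * H ^ 3 / (\<zeta> * \<delta>)"
  proof -
    have "\<zeta> * \<delta> < 1 * 1" using zeta delta by (intro mult_strict_mono) auto
    moreover have "1 * 1 * 1 \<le> 216 * ?SA * H ^ 3" using SA H by (intro mult_mono one_le_power) auto
    ultimately show ?thesis using zeta delta by (simp add: less_divide_eq)
  qed
  with q_ge have q1: "1 < q" by simp
  define L where "L = ln q"
  have L: "0 < L" "exp (- L) = 1 / q" using q1 by (auto simp: L_def exp_minus field_simps)
  define l where "l = L / real n"
  have n0: "0 < n" using n by simp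
  \<comment> \<open>As \<open>\<beta> = 2 * L\<close>, the second claim is exactly the assumed lower
    bound on \<open>n\<close>.\<close>
  have l: "0 < l" "128 * l \<le> 1 - \<gamma>"
    using L n_ge n g by (auto simp: l_def q(1) L_def field_simps)
  \<comment> \<open>The net costs \<open>2 * 7 * e = 7/8 * \<zeta>\<close>, which together with the
    \<open>\<zeta>\<close> of the perturbation stays below \<open>2 * \<zeta>\<close>. Covering
    values up to \<open>3/2 * H\<close> then takes about \<open>24 * H / \<zeta>\<close>
    points.\<close>
  define e where "e = \<zeta> / 16"
  have e: "0 < e" using zeta by (simp add: e_def)
  define N where "N = nat \<lfloor>24 * H / \<zeta>\<rfloor>"
  have "0 \<le> 24 * H / \<zeta>" using H zeta by simp
  then have N: "real N \<le> 24 * H / \<zeta>" "24 * H / \<zeta> < real N + 1" by (auto simp: N_def of_nat_nat)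
  have N_e: "(3/2) / (1 - \<gamma>) < (real N + 1) * e"
  proof -
    have "(24 * H / \<zeta>) * e < (real N + 1) * e" by (rule mult_strict_right_mono[OF N(2) e])
    moreover have "(24 * H / \<zeta>) * e = 3/2 * H" using zeta by (simp add: e_def)
    ultimately show ?thesis by (simp add: H_def)
  qed
  \<comment> \<open>The number of iterations does not enter the union bound, so mere existence of
    \<open>k\<close> is enough.\<close>
  have "0 < e / (3/2 * H)" using e H by simp
  then obtain k where "\<gamma> ^ k < e / (3/2 * H)" using real_arch_pow_inv[of _ \<gamma>] g by blast
  then have k: "\<gamma> ^ k * ((3/2) / (1 - \<gamma>)) \<le> e" using H by (simp add: H_def field_simps)
  obtain pol' where opt: "pol_value \<gamma> P r pol' = bellman \<gamma> r P (\<lambda>_. UNIV) (pol_value \<gamma> P r pol')"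
    unfolding pol_value_eq_resolvent by (rule exists_optimal_policy[OF g(1,2), of P r])
  define \<A> :: "('s \<Rightarrow> 'a set) set" where "\<A> = {\<lambda>_. UNIV, \<lambda>s. {pol' s}}"
  have \<A>: "finite \<A>" "card \<A> \<le> 2" by (auto simp: \<A>_def card_insert_if)
  have prob: "real (card \<A> * (CARD('s) * CARD('a)) * Suc N) * (2 * exp (- L)) \<le> \<delta>"
  proof -
    have "\<zeta> \<le> H" using zeta H by simp
    then have "1 \<le> H / \<zeta>" using zeta by simp
    with N(1) have N': "real (Suc N) \<le> 25 * H / \<zeta>" by simp
    have "real (card \<A> * (CARD('s) * CARD('a)) * Suc N) * (2 * exp (- L))
        = real (card \<A>) * ?SA * real (Suc N) * (2 / q)" unfolding L(2) of_nat_mult by simp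
    also have "\<dots> \<le> 2 * ?SA * (25 * H / \<zeta>) * (2 / (216 * ?SA * H ^ 3 / (\<zeta> * \<delta>)))"
    proof (intro mult_mono divide_left_mono)
      show "216 * ?SA * H ^ 3 / (\<zeta> * \<delta>) \<le> q" by (rule q_ge)
      show "0 < q * (216 * ?SA * H ^ 3 / (\<zeta> * \<delta>))" using q1 SA H zeta delta by simp
    qed (use \<A>(2) N' SA H zeta q1 in auto)
    \<comment> \<open>Here \<open>100 = 2 * 25 * 2\<close>; the net uses up one power of
      \<open>H\<close>, and \<open>H \<ge> 2\<close> handles the rest.\<close>
    also have "\<dots> = \<delta> * (100 / (216 * H\<^sup>2))"
      using SA H zeta delta by (simp add: field_simps power2_eq_square power3_eq_cube)
    also have "\<dots> \<le> \<delta> * 1"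
      using H delta power_mono[OF H(1), of 2] by (intro mult_left_mono) (auto simp: field_simps)
    finally show ?thesis by simp
  qed
  define E where "E = {\<omega> \<in> space (pmbp_space P \<zeta> n). (\<forall>sa. 0 \<le> fst \<omega> sa \<and> fst \<omega> sa \<le> \<zeta>)
      \<and> net_close \<gamma> P n \<A> (L / n) N e k (pert_reward r (fst \<omega>)) (snd \<omega>)}"
  note event = pmbp_net_event[OF zeta(1) n0 L(1) \<A>(1) prob, where \<gamma>=\<gamma> and e=e and k=k and r=r and P=P, folded E_def]
  show ?thesis
  proof (intro bexI[OF _ event(1)] conjI event(2) ballI allI impI)
    fix \<omega> pol s
    assume \<omega>: "\<omega> \<in> E" and out: "pmbp_output \<gamma> r n \<omega> pol"
    obtain Z X where ZX: "\<omega> = (Z, X)" by force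
    have "opt_value \<gamma> P r s - pol_value \<gamma> P r pol s
      \<le> \<zeta> / (1 - \<gamma>) + 2 * ((11 * sqrt (l * ((3/2) * t_minorize P)) + 7 * e) / (1 - \<gamma>))"
      by (rule pmbp_gap[OF gamma r erg tmin _ zeta(2) n0 l e N_e k opt _ out[unfolded ZX]])
        (use \<omega> in \<open>auto simp: ZX E_def net_close_def \<A>_def l_def\<close>)
    also have "\<dots> = \<zeta> * H + 7/8 * (\<zeta> * H) + 22 * (H * sqrt (l * ((3/2) * T)))"
    proof -
      have "x / (1 - \<gamma>) = x * H" for x by (simp add: H_def)
      then show ?thesis unfolding e_def T_def by (simp add: algebra_simps)
    qed
    \<comment> \<open>Passing from \<open>l\<close> to \<open>\<beta> / n\<close> gains a factor 2,
      which covers the 3/2.\<close>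
    also have "sqrt (l * ((3/2) * T)) \<le> sqrt (\<beta> * T / real n)"
    proof (rule real_sqrt_le_mono)
      have "0 \<le> T * l" using t_minorize_ge_1[OF erg] l by (simp add: T_def)
      moreover have "\<beta> * T / real n = 2 * (T * l)" by (simp add: q(1) l_def L_def)
      ultimately show "l * ((3/2) * T) \<le> \<beta> * T / real n" by simp
    qed
    also have "H * sqrt (\<beta> * T / real n) = sqrt (\<beta> * t_minorize P / ((1 - \<gamma>)^2 * real n))"
      using g by (simp add: H_def T_def real_sqrt_divide real_sqrt_mult field_simps)
    finally have *: "opt_value \<gamma> P r s - pol_value \<gamma> P r pol s \<le> \<zeta> * H + 7/8 * (\<zeta> * H)
        + 22 * sqrt (\<beta> * t_minorize P / ((1 - \<gamma>)^2 * real n))" using H by simp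
    have "0 \<le> \<beta> * t_minorize P / ((1 - \<gamma>)^2 * real n)"
      using t_minorize_ge_1[OF erg] L(1) by (simp add: q(1) L_def)
    then have "0 \<le> sqrt (\<beta> * t_minorize P / ((1 - \<gamma>)^2 * real n))" by simp
    moreover have "0 \<le> \<zeta> * H" using zeta H by simp
    moreover have "2 * \<zeta> / (1 - \<gamma>) = 2 * (\<zeta> * H)" by (simp add: H_def)
    ultimately show "opt_value \<gamma> P r s - pol_value \<gamma> P r pol s
            \<le> 2 * \<zeta> / (1 - \<gamma>) + 486 * sqrt (\<beta> * t_minorize P / ((1 - \<gamma>)^2 * real n))"
      using * by linarith
  qed
qed

text \<open>For \<open>\<zeta> \<ge> 1/2\<close> the bound exceeds \<open>1 / (1 - \<gamma>)\<close> even where \<open>beta_delta\<close> is negative,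
  in which case Isabelle's \<open>sqrt\<close> is negative as well.\<close>

lemma horizon_le_large_noise_bound:
  fixes \<gamma> \<zeta> \<delta> T :: real
  assumes gamma: "1/2 \<le> \<gamma>" "\<gamma> < 1" and delta: "0 < \<delta>" "\<delta> < 1"
    and T: "0 \<le> T" "T \<le> 1 / (1 - \<gamma>)"
    and zeta: "1/2 \<le> \<zeta>" and n: "1 \<le> n"
  defines "\<beta> \<equiv> beta_delta TYPE('s::finite) TYPE('a::finite) \<gamma> \<delta> (eta_star TYPE('s) TYPE('a) \<gamma> \<zeta> \<delta>)"
  shows "1 / (1 - \<gamma>) \<le> 2 * \<zeta> / (1 - \<gamma>) + 486 * sqrt (\<beta> * T / ((1 - \<gamma>)^2 * real n))"
proof (cases "0 \<le> \<beta>")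
  case True
  then have "0 \<le> sqrt (\<beta> * T / ((1 - \<gamma>)^2 * real n))" using T by simp
  moreover have "1 / (1 - \<gamma>) \<le> 2 * \<zeta> / (1 - \<gamma>)" using gamma zeta by (intro divide_right_mono) auto
  ultimately show ?thesis by linarith
next
  case False
  define H where "H = 1 / (1 - \<gamma>)"
  have H: "2 \<le> H" "0 < H" using gamma by (auto simp: H_def field_simps)
  let ?SA = "real CARD('s) * real CARD('a)"
  have SA: "1 \<le> ?SA" using mult_mono[of 1 "real CARD('s)" 1 "real CARD('a)"] by (simp add: Suc_leI)
  have zeta0: "0 < \<zeta>" using zeta by simp
  obtain q where q: "\<beta> = 2 * ln q" "216 * ?SA / ((1 - \<gamma>) ^ 3 * (\<zeta> * \<delta>)) \<le> q"
    unfolding \<beta>_def by (rule beta_delta_eta_star[OF gamma zeta0 delta])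
  have "216 * H ^ 3 / \<zeta> = 216 * 1 * H ^ 3 / (\<zeta> * 1)" by simp
  also have "\<dots> \<le> 216 * ?SA * H ^ 3 / (\<zeta> * \<delta>)"
    using SA H zeta0 delta by (intro frac_le mult_mono) auto
  also have "\<dots> \<le> q" using q(2) by (simp add: H_def power_one_over field_simps)
  finally have q_ge: "216 * H ^ 3 / \<zeta> \<le> q" .
  have q0: "0 < q" using q_ge H zeta0 by (smt (verit) divide_pos_pos zero_less_power)
  have q1: "q < 1" using False q(1) q0 by (smt (verit) ln_ge_zero)
  have "216 * H ^ 3 / \<zeta> \<le> 1" using q_ge q1 by simp
  \<comment> \<open>A negative \<open>\<beta>\<close> forces a huge \<open>\<zeta>\<close>, for
    which the linear term dominates the negative root.\<close>
  then have "216 * H ^ 3 \<le> \<zeta>" using zeta0 by (simp add: pos_divide_le_eq)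
  with power_mono[OF H(1), of 3] have zeta_ge: "1728 \<le> \<zeta>" by simp
  have "- \<beta> = 2 * ln (1 / q)" using q0 by (simp add: q(1) ln_div)
  also have "\<dots> \<le> 2 * (1 / q)" using ln_le_minus_one[of "1 / q"] q0 by simp
  also have "\<dots> \<le> 2 * (\<zeta> / (216 * H ^ 3))"
    using q_ge q0 H zeta0 by (simp add: field_simps)
  finally have beta: "- \<beta> \<le> \<zeta> / (108 * H ^ 3)" by simp
  define x where "x = - \<beta> * T / ((1 - \<gamma>)^2 * real n)"
  have "x = (- \<beta>) * T * H\<^sup>2 / real n" by (simp add: x_def H_def power_one_over field_simps)
  also have "\<dots> \<le> (- \<beta>) * T * H\<^sup>2 / 1" using False T n by (intro divide_left_mono mult_nonneg_nonneg) auto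
  also have "\<dots> \<le> (\<zeta> / (108 * H ^ 3)) * H * H\<^sup>2 / 1"
    using beta T H False zeta0 by (intro divide_right_mono mult_mono) (auto simp: H_def)
  also have "\<dots> = \<zeta> / 108" using H by (simp add: power2_eq_square power3_eq_cube)
  finally have x: "x \<le> \<zeta> / 108" .
  have "486 * sqrt x = sqrt (486\<^sup>2 * x)" by (simp add: real_sqrt_mult)
  also have "\<dots> \<le> 2 * \<zeta>"
  proof (rule real_le_lsqrt)
    \<comment> \<open>\<open>486^2 / 108 = 2187\<close>, which \<open>zeta_ge\<close> places below
      \<open>4 * \<zeta>\<close>.\<close>
    have "486\<^sup>2 * x \<le> 2187 * \<zeta>" using x by simp
    also have "\<dots> \<le> (4 * \<zeta>) * \<zeta>" using zeta_ge by (intro mult_right_mono) auto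
    finally show "486\<^sup>2 * x \<le> (2 * \<zeta>)\<^sup>2" by (simp add: power2_eq_square)
  qed (use zeta0 in auto)
  finally have "486 * sqrt x \<le> 2 * \<zeta>" .
  moreover have "2 * (2 * \<zeta> - 1) \<le> H * (2 * \<zeta> - 1)" using H zeta by (intro mult_right_mono) auto
  moreover have "sqrt (\<beta> * T / ((1 - \<gamma>)^2 * real n)) = - sqrt x"
    by (simp add: x_def real_sqrt_minus[symmetric])
  moreover have "2 * \<zeta> / (1 - \<gamma>) = H * (2 * \<zeta>)" by (simp add: H_def)
  ultimately show ?thesis unfolding H_def[symmetric] using zeta_ge by (simp add: algebra_simps)
qed

text \<open>Small noise is the probabilistic case; for large noise the bound holds surely, and the
  whole space serves as the event.\<close>

lemma pmbp_bound:
  fixes r :: "'s::finite \<Rightarrow> 'a::finite \<Rightarrow> real"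
    and P :: "'s \<Rightarrow> 'a \<Rightarrow> 's pmf"
    and \<gamma> \<delta> \<zeta> :: real
  assumes r: "\<And>s a. 0 \<le> r s a \<and> r s a \<le> 1"
    and erg: "uniformly_ergodic P"
    and gamma: "1/2 \<le> \<gamma>" "\<gamma> < 1"
    and tmin: "t_minorize P \<le> 1 / (1 - \<gamma>)"
    and delta: "0 < \<delta>" "\<delta> < 1"
    and zeta: "0 < \<zeta>" and n: "1 \<le> n"
  defines "\<beta> \<equiv> beta_delta TYPE('s) TYPE('a) \<gamma> \<delta> (eta_star TYPE('s) TYPE('a) \<gamma> \<zeta> \<delta>)"
  assumes n_ge: "real n \<ge> 64 * \<beta> / (1 - \<gamma>)"
  shows "\<exists>E \<in> sets (pmbp_space P \<zeta> n). measure (pmbp_space P \<zeta> n) E \<ge> 1 - \<delta> \<and>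
    (\<forall>\<omega>\<in>E. \<forall>pol. pmbp_output \<gamma> r n \<omega> pol \<longrightarrow>
      (\<forall>s. 0 \<le> opt_value \<gamma> P r s - pol_value \<gamma> P r pol s \<and>
           opt_value \<gamma> P r s - pol_value \<gamma> P r pol s
            \<le> 2 * \<zeta> / (1 - \<gamma>) + 486 * sqrt (\<beta> * t_minorize P / ((1 - \<gamma>)^2 * real n))))"
proof (cases "\<zeta> \<le> 1/2")
  case True
  from pmbp_bound_small_noise[OF r erg gamma tmin delta zeta True n n_ge[unfolded \<beta>_def]]
  show ?thesis unfolding \<beta>_def using opt_value_ge[of \<gamma> P r] by (simp add: diff_ge_0_iff_ge)
next
  case False
  interpret prob_space "pmbp_space P \<zeta> n" by (rule prob_space_pmbp_space[OF zeta])
  have g: "0 \<le> \<gamma>" "\<gamma> < 1" using gamma by auto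
  have "1 / (1 - \<gamma>) \<le> 2 * \<zeta> / (1 - \<gamma>) + 486 * sqrt (\<beta> * t_minorize P / ((1 - \<gamma>)^2 * real n))"
    unfolding \<beta>_def
    by (rule horizon_le_large_noise_bound) (use gamma delta tmin n False t_minorize_ge_1[OF erg] in auto)
  then have "opt_value \<gamma> P r s - pol_value \<gamma> P r pol s
      \<le> 2 * \<zeta> / (1 - \<gamma>) + 486 * sqrt (\<beta> * t_minorize P / ((1 - \<gamma>)^2 * real n))" for pol s
    using value_gap_le_horizon[where P=P and s=s and pol=pol and r=r, OF g r] by linarith
  then show ?thesis
    using delta opt_value_ge[of \<gamma> P r]
    by (intro bexI[of _ "space (pmbp_space P \<zeta> n)"]) (auto simp: prob_space)
qed

theorem theorem1:
  fixes r :: "'s::finite \<Rightarrow> 'a::finite \<Rightarrow> real"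
    and P :: "'s \<Rightarrow> 'a \<Rightarrow> 's pmf"
    and \<gamma> \<delta> :: real
  assumes r_range: "\<And>s a. 0 \<le> r s a \<and> r s a \<le> 1"
    and ergodic: "uniformly_ergodic P"
    and gamma: "1/2 \<le> \<gamma>" "\<gamma> < 1"
    and tmin: "t_minorize P \<le> 1 / (1 - \<gamma>)"
    and delta: "0 < \<delta>" "\<delta> < 1"
  shows
    "(\<forall>(\<zeta>::real) (n::nat). 0 < \<zeta> \<longrightarrow> 1 \<le> n \<longrightarrow>
        real n \<ge> 64 * beta_delta TYPE('s) TYPE('a) \<gamma> \<delta> (eta_star TYPE('s) TYPE('a) \<gamma> \<zeta> \<delta>) / (1 - \<gamma>) \<longrightarrow>
        (\<exists>E \<in> sets (pmbp_space P \<zeta> n).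
           measure (pmbp_space P \<zeta> n) E \<ge> 1 - \<delta> \<and>
           (\<forall>\<omega>\<in>E. \<forall>pol. pmbp_output \<gamma> r n \<omega> pol \<longrightarrow>
              (\<forall>s. 0 \<le> opt_value \<gamma> P r s - pol_value \<gamma> P r pol s \<and>
                   opt_value \<gamma> P r s - pol_value \<gamma> P r pol s
                   \<le> 2 * \<zeta> / (1 - \<gamma>)
                     + 486 * sqrt (beta_delta TYPE('s) TYPE('a) \<gamma> \<delta> (eta_star TYPE('s) TYPE('a) \<gamma> \<zeta> \<delta>)
                                   * t_minorize P / ((1 - \<gamma>)^2 * real n))))))
   \<and>
    (\<forall>\<epsilon>::real. 0 < \<epsilon> \<longrightarrow> \<epsilon> \<le> sqrt (t_minorize P / (1 - \<gamma>)) \<longrightarrow>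
       (let \<zeta> = (1 - \<gamma>) * \<epsilon> / 4;
            n = nat \<lceil>4 * 486^2 * t_minorize P
                      * beta_delta TYPE('s) TYPE('a) \<gamma> \<delta> (eta_star TYPE('s) TYPE('a) \<gamma> \<zeta> \<delta>)
                      / ((1 - \<gamma>)^2 * \<epsilon>^2)\<rceil>
        in \<exists>E \<in> sets (pmbp_space P \<zeta> n).
             measure (pmbp_space P \<zeta> n) E \<ge> 1 - \<delta> \<and>
             (\<forall>\<omega>\<in>E. \<forall>pol. pmbp_output \<gamma> r n \<omega> pol \<longrightarrow>
                (\<forall>s. \<bar>opt_value \<gamma> P r s - pol_value \<gamma> P r pol s\<bar> \<le> \<epsilon>))))"
proof (intro conjI allI impI)
  fix \<zeta> :: real and n :: nat
  assume "0 < \<zeta>" "1 \<le> n"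
    "real n \<ge> 64 * beta_delta TYPE('s) TYPE('a) \<gamma> \<delta> (eta_star TYPE('s) TYPE('a) \<gamma> \<zeta> \<delta>) / (1 - \<gamma>)"
  from pmbp_bound[OF r_range ergodic gamma tmin delta this]
  show "\<exists>E \<in> sets (pmbp_space P \<zeta> n).
           measure (pmbp_space P \<zeta> n) E \<ge> 1 - \<delta> \<and>
           (\<forall>\<omega>\<in>E. \<forall>pol. pmbp_output \<gamma> r n \<omega> pol \<longrightarrow>
              (\<forall>s. 0 \<le> opt_value \<gamma> P r s - pol_value \<gamma> P r pol s \<and>
                   opt_value \<gamma> P r s - pol_value \<gamma> P r pol s
                   \<le> 2 * \<zeta> / (1 - \<gamma>)
                     + 486 * sqrt (beta_delta TYPE('s) TYPE('a) \<gamma> \<delta> (eta_star TYPE('s) TYPE('a) \<gamma> \<zeta> \<delta>)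
                                   * t_minorize P / ((1 - \<gamma>)^2 * real n))))" .
next
  fix \<epsilon> :: real
  assume eps: "0 < \<epsilon>" "\<epsilon> \<le> sqrt (t_minorize P / (1 - \<gamma>))"
  define \<zeta> where "\<zeta> = (1 - \<gamma>) * \<epsilon> / 4"
  define \<beta> where "\<beta> = beta_delta TYPE('s) TYPE('a) \<gamma> \<delta> (eta_star TYPE('s) TYPE('a) \<gamma> \<zeta> \<delta>)"
  define T where "T = t_minorize P"
  define y where "y = 4 * 486^2 * T * \<beta> / ((1 - \<gamma>)^2 * \<epsilon>^2)"
  define n where "n = nat \<lceil>y\<rceil>"
  have T: "1 \<le> T" "T \<le> 1 / (1 - \<gamma>)" using t_minorize_ge_1[OF ergodic] tmin by (auto simp: T_def)
  have g: "0 < 1 - \<gamma>" using gamma by simp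
  have eps2: "\<epsilon>\<^sup>2 \<le> T / (1 - \<gamma>)"
    using power_mono[OF eps(2), of 2] eps(1) T g by (simp add: T_def)
  also have "\<dots> \<le> (1 / (1 - \<gamma>))\<^sup>2"
    using mult_right_mono[OF T(2), of "1 / (1 - \<gamma>)"] g by (simp add: power2_eq_square)
  finally have "\<epsilon> \<le> 1 / (1 - \<gamma>)" by (rule power2_le_imp_le) (use g in simp)
  \<comment> \<open>\<open>\<zeta> \<le> 1\<close> puts the argument of the logarithm above 1, so
    \<open>\<beta>\<close> is positive and the prescribed \<open>n\<close> is at least 1.\<close>
  then have zeta: "0 < \<zeta>" "\<zeta> \<le> 1" using eps g by (auto simp: \<zeta>_def field_simps)
  obtain q where q: "\<beta> = 2 * ln q" "216 * (real CARD('s) * real CARD('a)) / ((1 - \<gamma>) ^ 3 * (\<zeta> * \<delta>)) \<le> q"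
    unfolding \<beta>_def by (rule beta_delta_eta_star[OF gamma zeta(1) delta])
  have "1 < 216 * (real CARD('s) * real CARD('a)) / ((1 - \<gamma>) ^ 3 * (\<zeta> * \<delta>))"
  proof -
    have "(1 - \<gamma>) ^ 3 * (\<zeta> * \<delta>) \<le> 1 * (1 * 1)"
      using zeta delta g gamma by (intro mult_mono power_le_one) auto
    moreover have "1 * 1 \<le> real CARD('s) * real CARD('a)" by (intro mult_mono) (auto simp: Suc_leI)
    ultimately show ?thesis using zeta delta g by (simp add: less_divide_eq)
  qed
  with q have beta: "0 < \<beta>" by simp
  have y: "0 < y" using T beta g eps by (simp add: y_def)
  then have "1 \<le> \<lceil>y\<rceil>" by (simp add: one_le_ceiling)
  then have n: "1 \<le> n" "y \<le> real n" by (auto simp: n_def of_nat_nat nat_le_iff le_nat_iff)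
  \<comment> \<open>The restriction on \<open>\<epsilon>\<close> enters here: \<open>eps2\<close>
    and \<open>64 \<le> 4 * 486^2\<close> yield the required sample size.\<close>
  have "64 * \<beta> / (1 - \<gamma>) = 64 * \<beta> * \<epsilon>\<^sup>2 / ((1 - \<gamma>) * \<epsilon>\<^sup>2)" using eps by simp
  also have "\<dots> \<le> (4 * 486^2) * \<beta> * (T / (1 - \<gamma>)) / ((1 - \<gamma>) * \<epsilon>\<^sup>2)"
    using eps2 beta g eps T by (intro divide_right_mono mult_mono) auto
  also have "\<dots> = y" by (simp add: y_def power2_eq_square mult.commute mult.left_commute)
  finally have n_ge: "real n \<ge> 64 * \<beta> / (1 - \<gamma>)" using n(2) by simp
  have "sqrt (\<beta> * T / ((1 - \<gamma>)^2 * real n)) \<le> sqrt (\<beta> * T / ((1 - \<gamma>)^2 * y))"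
    using n(2) y g beta T by (intro real_sqrt_le_mono divide_left_mono mult_left_mono) auto
  \<comment> \<open>Since \<open>4 * 486^2 = (2 * 486)^2\<close>, the statistical term gets half of
    \<open>\<epsilon>\<close>; the choice of \<open>\<zeta>\<close> leaves the other half to the
    perturbation.\<close>
  also have "\<beta> * T / ((1 - \<gamma>)^2 * y) = (\<epsilon> / (2 * 486))\<^sup>2"
  proof -
    define h where "h = 1 - \<gamma>"
    have "0 < h" using g by (simp add: h_def)
    then show ?thesis
      using beta T eps unfolding y_def h_def[symmetric] by (simp add: field_simps power2_eq_square)
  qed
  also have "sqrt \<dots> = \<epsilon> / (2 * 486)" using eps by simp
  finally have "486 * sqrt (\<beta> * T / ((1 - \<gamma>)^2 * real n)) \<le> \<epsilon> / 2" by simp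
  moreover have "2 * \<zeta> / (1 - \<gamma>) = \<epsilon> / 2" unfolding \<zeta>_def using g by (simp add: divide_eq_eq)
  ultimately have "2 * \<zeta> / (1 - \<gamma>) + 486 * sqrt (\<beta> * T / ((1 - \<gamma>)^2 * real n)) \<le> \<epsilon>"
    by linarith
  then have bound: "\<bar>x\<bar> \<le> \<epsilon>" if "0 \<le> x \<and> x \<le> 2 * \<zeta> / (1 - \<gamma>) + 486 * sqrt (\<beta> * T / ((1 - \<gamma>)^2 * real n))" for x
    using that by linarith
  obtain E where E: "E \<in> sets (pmbp_space P \<zeta> n)" "measure (pmbp_space P \<zeta> n) E \<ge> 1 - \<delta>"
    and gap: "\<And>\<omega> pol s. \<omega> \<in> E \<Longrightarrow> pmbp_output \<gamma> r n \<omega> pol \<Longrightarrow>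
      0 \<le> opt_value \<gamma> P r s - pol_value \<gamma> P r pol s \<and> opt_value \<gamma> P r s - pol_value \<gamma> P r pol s
        \<le> 2 * \<zeta> / (1 - \<gamma>) + 486 * sqrt (\<beta> * T / ((1 - \<gamma>)^2 * real n))"
    using pmbp_bound[where r=r, OF r_range ergodic gamma tmin delta zeta(1) n(1) n_ge[unfolded \<beta>_def]]
    unfolding \<beta>_def[symmetric] T_def[symmetric] by blast
  have "\<exists>E \<in> sets (pmbp_space P \<zeta> n). measure (pmbp_space P \<zeta> n) E \<ge> 1 - \<delta> \<and>
      (\<forall>\<omega>\<in>E. \<forall>pol. pmbp_output \<gamma> r n \<omega> pol \<longrightarrow>
        (\<forall>s. \<bar>opt_value \<gamma> P r s - pol_value \<gamma> P r pol s\<bar> \<le> \<epsilon>))"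
    by (intro bexI[OF _ E(1)] conjI E(2) ballI allI impI) (rule bound[OF gap])
  then show "let \<zeta> = (1 - \<gamma>) * \<epsilon> / 4;
            n = nat \<lceil>4 * 486^2 * t_minorize P
                      * beta_delta TYPE('s) TYPE('a) \<gamma> \<delta> (eta_star TYPE('s) TYPE('a) \<gamma> \<zeta> \<delta>)
                      / ((1 - \<gamma>)^2 * \<epsilon>^2)\<rceil>
        in \<exists>E \<in> sets (pmbp_space P \<zeta> n).
             measure (pmbp_space P \<zeta> n) E \<ge> 1 - \<delta> \<and>
             (\<forall>\<omega>\<in>E. \<forall>pol. pmbp_output \<gamma> r n \<omega> pol \<longrightarrow>
                (\<forall>s. \<bar>opt_value \<gamma> P r s - pol_value \<gamma> P r pol s\<bar> \<le> \<epsilon>))"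
    unfolding Let_def n_def y_def \<beta>_def T_def \<zeta>_def .
qed

end
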